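(* Let $1\le p\le\infty$, let $u,\psi$ be entire functions on $\mathbb{C}$ with $u$ non-vanishing on $\mathbb{C}$, and let the weighted composition operator $W_{(u,\psi)}$ be a compact power bounded operator on the Fock space $\mathcal{F}_p$ (hence $\psi(z)=az+b$ for some $a,b\in\mathbb{C}$ with $|a|<1$). Then $W_{(u,\psi)}$ is uniformly mean ergodic on $\mathcal{F}_p$.
   Context: For $1\le p<\infty$, the Fock space $\mathcal{F}_p$ consists of all entire functions $f$ on $\mathbb{C}$ with $\|f\|_p=\Big(\frac{p}{2\pi}\int_{\mathbb{C}}|f(z)|^pe^{-\frac{p|z|^2}{2}}dA(z)\Big)^{1/p}<\infty$, where $dA$ is Lebesgue area measure; $\mathcal{F}_\infty$ consists of all entire $f$ with $\|f\|_\infty=\sup_{z\in\mathbb{C}}|f(z)|e^{-\frac{|z|^2}{2}}<\infty$. For entire $u,\psi$, the weighted composition operator is $W_{(u,\psi)}f=u\cdot (f\circ\psi)$. A bounded operator $T$ on a Banach space $X$ is power bounded if $\sup_{n\in\mathbb{N}}\|T^n\|<\infty$; it is uniformly mean ergodic if there is a bounded operator $P$ on $X$ with $\lim_{n\to\infty}\big\|\frac1n\sum_{m=1}^nT^m-P\big\|=0$ in operator norm. *)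

theory Defs
  imports "HOL-Complex_Analysis.Complex_Analysis"
begin

type_synonym cfun = "complex \<Rightarrow> complex"

section \<open>Fock spaces\<close>

text \<open>
  The exponent \<open>p\<close> ranges over the extended nonnegative reals, so that \<open>p = \<infinity>\<close> is the supremum-norm case.
  For finite \<open>p\<close>, \<open>fock_size p f\<close> is the \<open>p\<close>-th power of the (possibly infinite) norm of \<open>f\<close>;
  for \<open>p = \<infinity>\<close> it is the norm itself. On complex numbers, \<open>lborel\<close> is area measure.
\<close>

definition fock_size :: "ennreal \<Rightarrow> cfun \<Rightarrow> ennreal" where
  "fock_size p f =
    (if p = \<infinity> then (SUP z. ennreal (cmod (f z) * exp (- ((cmod z)\<^sup>2 / 2))))
     else ennreal (enn2real p / (2 * pi)) *
       (\<integral>\<^sup>+ z. ennreal (cmod (f z) powr enn2real p * exp (- (enn2real p * (cmod z)\<^sup>2 / 2))) \<partial>lborel))"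

definition fock_space :: "ennreal \<Rightarrow> cfun set" where
  "fock_space p = {f. f holomorphic_on UNIV \<and> fock_size p f < \<infinity>}"

definition fock_norm :: "ennreal \<Rightarrow> cfun \<Rightarrow> real" where
  "fock_norm p f =
    (if p = \<infinity> then enn2real (fock_size p f)
     else enn2real (fock_size p f) powr (1 / enn2real p))"

definition weighted_comp :: "cfun \<Rightarrow> cfun \<Rightarrow> cfun \<Rightarrow> cfun" where
  "weighted_comp u \<psi> f = (\<lambda>z. u z * f (\<psi> z))"


section \<open>Operators on a normed space of functions\<close>

text \<open>
  Below \<open>X\<close> is a linear space of complex functions under the pointwise operations and \<open>N\<close> is a
  norm on \<open>X\<close>. Since the Fock space depends on the parameter \<open>p\<close>, it is not a type, and operators
  are total maps on functions of which only the restriction to \<open>X\<close> matters.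
\<close>

definition bounded_operator :: "cfun set \<Rightarrow> (cfun \<Rightarrow> real) \<Rightarrow> (cfun \<Rightarrow> cfun) \<Rightarrow> bool" where
  "bounded_operator X N T \<longleftrightarrow>
     (\<forall>f\<in>X. T f \<in> X) \<and>
     (\<forall>f\<in>X. \<forall>g\<in>X. T (\<lambda>z. f z + g z) = (\<lambda>z. T f z + T g z)) \<and>
     (\<forall>c. \<forall>f\<in>X. T (\<lambda>z. c * f z) = (\<lambda>z. c * T f z)) \<and>
     (\<exists>C. \<forall>f\<in>X. N (T f) \<le> C * N f)"

text \<open>A supremum of reals, hence meaningful only for operators that are bounded on \<open>X\<close>.\<close>

definition operator_norm :: "cfun set \<Rightarrow> (cfun \<Rightarrow> real) \<Rightarrow> (cfun \<Rightarrow> cfun) \<Rightarrow> real" where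
  "operator_norm X N T = (SUP f\<in>{f\<in>X. N f \<le> 1}. N (T f))"

definition norm_topology :: "cfun set \<Rightarrow> (cfun \<Rightarrow> real) \<Rightarrow> cfun topology" where
  "norm_topology X N = Metric_space.mtopology X (\<lambda>f g. N (\<lambda>z. f z - g z))"

definition compact_operator :: "cfun set \<Rightarrow> (cfun \<Rightarrow> real) \<Rightarrow> (cfun \<Rightarrow> cfun) \<Rightarrow> bool" where
  "compact_operator X N T \<longleftrightarrow>
     bounded_operator X N T \<and>
     compactin (norm_topology X N) (norm_topology X N closure_of (T ` {f\<in>X. N f \<le> 1}))"

definition power_bounded :: "cfun set \<Rightarrow> (cfun \<Rightarrow> real) \<Rightarrow> (cfun \<Rightarrow> cfun) \<Rightarrow> bool" where
  "power_bounded X N T \<longleftrightarrow>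
     bounded_operator X N T \<and> bdd_above (range (\<lambda>n. operator_norm X N (T ^^ n)))"

definition uniformly_mean_ergodic :: "cfun set \<Rightarrow> (cfun \<Rightarrow> real) \<Rightarrow> (cfun \<Rightarrow> cfun) \<Rightarrow> bool" where
  "uniformly_mean_ergodic X N T \<longleftrightarrow>
     bounded_operator X N T \<and>
     (\<exists>P. bounded_operator X N P \<and>
       (\<lambda>n. operator_norm X N
          (\<lambda>f z. (1 / of_nat n) * (\<Sum>m=1..n. (T ^^ m) f z) - P f z)) \<longlonglongrightarrow> 0)"

end

(*
  The weighted Weyl kernels k_w(z) = exp (conj w z - |w|^2 / 2) are bounded in the Fock space and
  tend to 0 pointwise as w tends to infinity. Evaluating W k_w at a point z with psi z = w gives
  |u z| exp (|psi z|^2 / 2 - |z|^2 / 2) <= C ||W k_w||. Boundedness of the right-hand side and a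
  zero-free u force psi to be affine, psi z = a z + b; by compactness the right-hand side tends to 0
  as w tends to infinity, and Liouville's theorem excludes |a| >= 1.

  Hence psi has an attracting fixed point z0, and W^n f = (W^n 1) (f o psi^n) tends to 0 pointwise,
  uniformly over bounded sets of f with f z0 = 0. Since a compact operator turns bounded sequences
  with pointwise null images into sequences with norm-null images, ||W^n|| tends to 0 on the
  hyperplane f z0 = 0. It remains to control the Cesaro means on a single function not vanishing
  at z0.
*)

theory Submission
  imports Defs "HOL-Probability.Distributions"
begin

section \<open>Compact power bounded operators on normed function spaces\<close>

text \<open>Since \<open>\<psi>\<close> fixes \<open>z0\<close>, evaluation at \<open>z0\<close> is
  an eigenfunctional: \<open>W f z0 = u z0 * f z0\<close>. The hyperplane \<open>f z0 = 0\<close> is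
  therefore invariant, and modulo it the operator is multiplication by the number
  \<open>u z0\<close>. Only this one dimension can keep the means from tending to 0, and the limit
  has the form \<open>f \<mapsto> f z0 * q\<close>. Pointwise convergence plays the part of weak
  convergence: evaluations are continuous, so a norm limit is determined by its values. Power
  boundedness bounds the weights \<open>W^n 1\<close> at each point, while the Schwarz lemma makes
  the factors f o psi^n small. The growth bound needs the exact weight exp (|z|^2 / 2). Kernels of
  bounded norm attain it on the diagonal, and this sharpness produces the ratio that controls
  \<open>\<psi>\<close>. The exponent \<open>p\<close> enters only when the growth bound, the
  kernels and the norm axioms are verified.\<close>

locale normed_function_space =
  fixes X :: "cfun set" and N :: "cfun \<Rightarrow> real"
  assumes add_mem: "\<And>f g. f \<in> X \<Longrightarrow> g \<in> X \<Longrightarrow> (\<lambda>z. f z + g z) \<in> X"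
    and scale_mem: "\<And>f c. f \<in> X \<Longrightarrow> (\<lambda>z. c * f z) \<in> X"
    and norm_nonneg: "\<And>f. 0 \<le> N f"
    and norm_uminus: "\<And>f. N (\<lambda>z. - f z) = N f"
    and norm_add: "\<And>f g. f \<in> X \<Longrightarrow> g \<in> X \<Longrightarrow> N (\<lambda>z. f z + g z) \<le> N f + N g"
    and norm_scale: "\<And>f c. f \<in> X \<Longrightarrow> N (\<lambda>z. c * f z) = cmod c * N f"
    and eval_bound: "\<And>z. \<exists>L. \<forall>f\<in>X. cmod (f z) \<le> L * N f"
    and one_mem: "(\<lambda>z. 1) \<in> X"
begin

lemma diff_mem: "f \<in> X \<Longrightarrow> g \<in> X \<Longrightarrow> (\<lambda>z. f z - g z) \<in> X"
  using add_mem[of f "\<lambda>z. -1 * g z"] scale_mem[of g "-1"] by simp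

lemma zero_mem: "(\<lambda>z. 0) \<in> X"
  using scale_mem[OF one_mem, of 0] by simp

lemma norm_zero_fun: "N (\<lambda>z. 0) = 0"
  using norm_scale[OF zero_mem, of 0] by simp

lemma norm_diff: "f \<in> X \<Longrightarrow> g \<in> X \<Longrightarrow> N (\<lambda>z. f z - g z) \<le> N f + N g"
  using norm_add[of f "\<lambda>z. -1 * g z"] scale_mem[of g "-1"] norm_scale[of g "-1"] by simp

lemma norm_diff_commute: "N (\<lambda>z. f z - g z) = N (\<lambda>z. g z - f z)"
  using norm_uminus[of "\<lambda>z. f z - g z"] by simp

lemma eval_boundE:
  obtains L where "0 \<le> L" "\<And>f. f \<in> X \<Longrightarrow> cmod (f z) \<le> L * N f"
proof -
  obtain L where L: "\<forall>f\<in>X. cmod (f z) \<le> L * N f"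
    using eval_bound by blast
  show thesis
  proof (rule that[of "max L 0"])
    fix f assume "f \<in> X"
    then have "cmod (f z) \<le> L * N f" using L by blast
    also have "\<dots> \<le> max L 0 * N f"
      by (intro mult_right_mono norm_nonneg) auto
    finally show "cmod (f z) \<le> max L 0 * N f" .
  qed auto
qed

lemma sum_mem_norm:
  assumes "finite I" "\<And>i. i \<in> I \<Longrightarrow> f i \<in> X"
  shows "(\<lambda>z. \<Sum>i\<in>I. f i z) \<in> X \<and> N (\<lambda>z. \<Sum>i\<in>I. f i z) \<le> (\<Sum>i\<in>I. N (f i))"
  using assms
proof (induction I rule: finite_induct)
  case empty
  then show ?case by (simp add: zero_mem norm_zero_fun)
next
  case (insert i I)
  then have "(\<lambda>z. \<Sum>i\<in>I. f i z) \<in> X" "f i \<in> X"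
    and "N (\<lambda>z. \<Sum>i\<in>I. f i z) \<le> (\<Sum>i\<in>I. N (f i))"
    by auto
  with insert.hyps add_mem[of "f i" "\<lambda>z. \<Sum>i\<in>I. f i z"]
    norm_add[of "f i" "\<lambda>z. \<Sum>i\<in>I. f i z"] show ?case
    by simp
qed

text \<open>\<open>Metric_space\<close> demands nonnegativity and symmetry of the distance for all
  arguments, members of \<open>X\<close> or not; hence \<open>norm_nonneg\<close> and
  \<open>norm_uminus\<close> carry no membership condition. Definiteness comes from the point
  evaluations.\<close>

lemma metric: "Metric_space X (\<lambda>f g. N (\<lambda>z. f z - g z))"
proof
  fix f g assume fg: "f \<in> X" "g \<in> X"
  show "N (\<lambda>z. f z - g z) = 0 \<longleftrightarrow> f = g"
  proof
    assume 0: "N (\<lambda>z. f z - g z) = 0"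
    have "f z = g z" for z
    proof -
      obtain L where "0 \<le> L" "\<And>f. f \<in> X \<Longrightarrow> cmod (f z) \<le> L * N f"
        using eval_boundE by blast
      then have "cmod (f z - g z) \<le> L * N (\<lambda>z. f z - g z)"
        using diff_mem[OF fg] by blast
      with 0 show ?thesis by simp
    qed
    then show "f = g" by auto
  qed (simp add: norm_zero_fun)
next
  fix f g h assume *: "f \<in> X" "g \<in> X" "h \<in> X"
  show "N (\<lambda>z. f z - h z) \<le> N (\<lambda>z. f z - g z) + N (\<lambda>z. g z - h z)"
    using norm_add[of "\<lambda>z. f z - g z" "\<lambda>z. g z - h z"] * by (simp add: diff_mem)
qed (auto simp: norm_nonneg intro: norm_diff_commute)

lemma pointwise_limit:
  assumes "\<And>j. f j \<in> X" "g \<in> X" "(\<lambda>j. N (\<lambda>z. f j z - g z)) \<longlonglongrightarrow> 0"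
  shows "(\<lambda>j. f j z) \<longlonglongrightarrow> g z"
proof -
  obtain L where L: "0 \<le> L" "\<And>f. f \<in> X \<Longrightarrow> cmod (f z) \<le> L * N f"
    using eval_boundE by blast
  have "(\<lambda>j. L * N (\<lambda>z. f j z - g z)) \<longlonglongrightarrow> 0"
    using tendsto_mult_left[OF assms(3), of L] by simp
  then have "(\<lambda>j. f j z - g z) \<longlonglongrightarrow> 0"
  proof (rule Lim_null_comparison[rotated])
    show "\<forall>\<^sub>F j in sequentially. norm (f j z - g z) \<le> L * N (\<lambda>z. f j z - g z)"
      using L(2)[OF diff_mem[OF assms(1,2)]] by simp
  qed
  then show ?thesis by (rule LIM_zero_cancel)
qed

end

section \<open>Cesaro means\<close>

lemma cesaro_mean_null:
  fixes \<delta> :: "nat \<Rightarrow> real"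
  assumes "\<delta> \<longlonglongrightarrow> 0"
  shows "(\<lambda>n. (1 / real n) * (\<Sum>m=1..n. \<delta> m)) \<longlonglongrightarrow> 0"
proof (rule LIMSEQ_I)
  fix r :: real assume r: "0 < r"
  obtain n0 where n0: "\<And>m. m \<ge> n0 \<Longrightarrow> \<bar>\<delta> m\<bar> < r / 2"
    using LIMSEQ_D[OF assms, of "r/2"] r by auto
  \<comment> \<open>The terms before \<open>n0\<close> contribute at most \<open>S\<close> to every
    sum, the others at most \<open>r / 2\<close> each; beyond \<open>n1\<close>, \<open>S\<close>
    itself is below \<open>n * (r / 2)\<close>.\<close>
  define S where "S = (\<Sum>m<n0. \<bar>\<delta> m\<bar>)"
  have S: "0 \<le> S" unfolding S_def by (simp add: sum_nonneg)
  obtain n1 where n1: "real n1 > 2 * S / r" using reals_Archimedean2 by blast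
  show "\<exists>no. \<forall>n\<ge>no. norm ((1 / real n) * (\<Sum>m=1..n. \<delta> m) - 0) < r"
  proof (intro exI allI impI)
    fix n assume n: "n \<ge> max 1 n1"
    have "\<bar>\<Sum>m=1..n. \<delta> m\<bar> \<le> (\<Sum>m=1..n. \<bar>\<delta> m\<bar>)" by (rule sum_abs)
    also have "\<dots> \<le> (\<Sum>m=1..n. (if m < n0 then \<bar>\<delta> m\<bar> else 0) + r / 2)"
      using n0 r by (intro sum_mono) (auto simp: less_imp_le not_less)
    also have "\<dots> = (\<Sum>m=1..n. (if m < n0 then \<bar>\<delta> m\<bar> else 0)) + n * (r / 2)"
      by (simp add: sum.distrib)
    also have "(\<Sum>m=1..n. (if m < n0 then \<bar>\<delta> m\<bar> else 0)) = (\<Sum>m\<in>{1..n} \<inter> {m. m < n0}. \<bar>\<delta> m\<bar>)"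
      by (simp add: sum.If_cases)
    also have "\<dots> \<le> S"
      unfolding S_def by (intro sum_mono2) auto
    also have "S < n * (r / 2)"
    proof -
      have "2 * S / r < real n" using n1 n by linarith
      then show ?thesis using r by (simp add: field_simps)
    qed
    finally show "norm ((1 / real n) * (\<Sum>m=1..n. \<delta> m) - 0) < r"
      using n r by (simp add: field_simps abs_mult)
  qed
qed

definition cesaro_mean :: "(cfun \<Rightarrow> cfun) \<Rightarrow> nat \<Rightarrow> cfun \<Rightarrow> cfun" where
  "cesaro_mean T n f = (\<lambda>z. (1 / of_nat n) * (\<Sum>m=1..n. (T ^^ m) f z))"

section \<open>Powers of a compact power bounded operator\<close>

locale compact_power_bounded_operator = normed_function_space +
  fixes T :: "cfun \<Rightarrow> cfun"
  assumes compact: "compact_operator X N T"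
    and power_bdd: "power_bounded X N T"
begin

lemma bounded: "bounded_operator X N T"
  using compact by (simp add: compact_operator_def)

lemma mem: "f \<in> X \<Longrightarrow> T f \<in> X"
  and map_add: "f \<in> X \<Longrightarrow> g \<in> X \<Longrightarrow> T (\<lambda>z. f z + g z) = (\<lambda>z. T f z + T g z)"
  and map_scale: "f \<in> X \<Longrightarrow> T (\<lambda>z. c * f z) = (\<lambda>z. c * T f z)"
  using bounded by (auto simp: bounded_operator_def)

lemma pow_mem: "f \<in> X \<Longrightarrow> (T ^^ n) f \<in> X"
  by (induction n) (auto simp: mem)

lemma pow_add:
  "f \<in> X \<Longrightarrow> g \<in> X \<Longrightarrow> (T ^^ n) (\<lambda>z. f z + g z) = (\<lambda>z. (T ^^ n) f z + (T ^^ n) g z)"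
  by (induction n) (auto simp: map_add pow_mem)

lemma pow_scale: "f \<in> X \<Longrightarrow> (T ^^ n) (\<lambda>z. c * f z) = (\<lambda>z. c * (T ^^ n) f z)"
  by (induction n) (auto simp: map_scale pow_mem)

lemma pow_diff:
  "f \<in> X \<Longrightarrow> g \<in> X \<Longrightarrow> (T ^^ n) (\<lambda>z. f z - g z) = (\<lambda>z. (T ^^ n) f z - (T ^^ n) g z)"
  using pow_add[of f "\<lambda>z. -1 * g z"] pow_scale[of g n "-1"] scale_mem[of g "-1"] by simp

lemma map_diff:
  "f \<in> X \<Longrightarrow> g \<in> X \<Longrightarrow> T (\<lambda>z. f z - g z) = (\<lambda>z. T f z - T g z)"
  using pow_diff[of f g 1] by simp

text \<open>A crude bound that makes the supremum in \<open>operator_norm\<close> a true upper bound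
  for each single power, and that settles the case \<open>N f = 0\<close>, where normalising is
  impossible.\<close>

lemma norm_pow_le_exp:
  obtains C where "0 \<le> C" "\<And>n f. f \<in> X \<Longrightarrow> N ((T ^^ n) f) \<le> C ^ n * N f"
proof -
  obtain C where C: "\<forall>f\<in>X. N (T f) \<le> C * N f"
    using bounded by (auto simp: bounded_operator_def)
  have step: "N (T f) \<le> max C 0 * N f" if "f \<in> X" for f
  proof -
    have "N (T f) \<le> C * N f" using C that by blast
    also have "\<dots> \<le> max C 0 * N f" by (intro mult_right_mono norm_nonneg) auto
    finally show ?thesis .
  qed
  show thesis
  proof (rule that[of "max C 0"])
    fix n f assume f: "f \<in> X"
    show "N ((T ^^ n) f) \<le> max C 0 ^ n * N f"
    proof (induction n)
      case (Suc n)
      have "N ((T ^^ Suc n) f) \<le> max C 0 * N ((T ^^ n) f)"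
        using step[OF pow_mem[OF f, of n]] by simp
      also have "\<dots> \<le> max C 0 * (max C 0 ^ n * N f)"
        using Suc by (intro mult_left_mono) auto
      finally show ?case by (simp add: mult.assoc)
    qed simp
  qed auto
qed

lemma power_boundE:
  obtains M where "0 \<le> M" "\<And>n f. f \<in> X \<Longrightarrow> N ((T ^^ n) f) \<le> M * N f"
proof -
  obtain C where C: "0 \<le> C" "\<And>n f. f \<in> X \<Longrightarrow> N ((T ^^ n) f) \<le> C ^ n * N f"
    using norm_pow_le_exp by blast
  obtain M where M: "\<And>n. operator_norm X N (T ^^ n) \<le> M"
    using power_bdd by (auto simp: power_bounded_def bdd_above_def)
  have unit: "N ((T ^^ n) f) \<le> M" if "f \<in> X" "N f \<le> 1" for n f
  proof -
    have "N ((T ^^ n) f) \<le> operator_norm X N (T ^^ n)"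
      unfolding operator_norm_def
    proof (rule cSUP_upper)
      show "bdd_above ((\<lambda>f. N ((T ^^ n) f)) ` {f \<in> X. N f \<le> 1})"
      proof (rule bdd_aboveI2)
        fix g assume "g \<in> {f \<in> X. N f \<le> 1}"
        then have g: "g \<in> X" "N g \<le> 1" by auto
        have "N ((T ^^ n) g) \<le> C ^ n * N g" by (rule C(2)[OF g(1)])
        also have "\<dots> \<le> C ^ n * 1" using g C(1) by (intro mult_left_mono) auto
        finally show "N ((T ^^ n) g) \<le> C ^ n" by simp
      qed
    qed (use that in auto)
    with M show ?thesis by (meson order_trans)
  qed
  show thesis
  proof (rule that)
    show "0 \<le> M"
      using unit[OF zero_mem, of 0] norm_nonneg norm_zero_fun by simp
    fix n f assume f: "f \<in> X"
    show "N ((T ^^ n) f) \<le> M * N f"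
    proof (cases "N f = 0")
      case True
      then show ?thesis using C(2)[OF f, of n] by simp
    next
      case False
      then have pos: "N f > 0" using norm_nonneg[of f] by simp
      let ?g = "\<lambda>z. of_real (1 / N f) * f z"
      have "?g \<in> X" by (rule scale_mem[OF f])
      moreover have "N ?g = 1" using norm_scale[OF f, of "of_real (1 / N f)"] pos
        by (simp add: norm_divide)
      ultimately have "N ((T ^^ n) ?g) \<le> M" using unit by simp
      moreover have "N ((T ^^ n) ?g) = (1 / N f) * N ((T ^^ n) f)"
        unfolding pow_scale[OF f] using norm_scale[OF pow_mem[OF f], of "of_real (1 / N f)" n] pos
        by (simp add: norm_divide)
      ultimately have "(1 / N f) * N ((T ^^ n) f) \<le> M" by metis
      then show ?thesis using pos by (simp add: pos_divide_le_eq)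
    qed
  qed
qed

lemma compact_subseq:
  assumes f: "\<And>j. f j \<in> X" and M: "\<And>j. N (f j) \<le> M"
  obtains g and r :: "nat \<Rightarrow> nat" where "g \<in> X" "strict_mono r"
    "(\<lambda>j. N (\<lambda>z. T (f (r j)) z - g z)) \<longlonglongrightarrow> 0"
proof -
  interpret ms: Metric_space X "\<lambda>f g. N (\<lambda>z. f z - g z)" by (rule metric)
  \<comment> \<open>\<open>compact_operator\<close> speaks of the unit ball only, so the sequence is
    divided by a bound that is also positive.\<close>
  define M' where "M' = max M 1"
  have M': "0 < M'" "\<And>j. N (f j) \<le> M'"
    using M by (auto simp: M'_def le_max_iff_disj)
  let ?b = "\<lambda>j z. of_real (1 / M') * f j z"
  have b: "?b j \<in> X" for j by (rule scale_mem[OF f])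
  have Nb: "N (?b j) \<le> 1" for j
    using norm_scale[OF f, of "of_real (1 / M')"] M' by (simp add: norm_divide)
  let ?B = "T ` {f \<in> X. N f \<le> 1}"
  have "?B \<subseteq> ms.mtopology closure_of ?B"
    by (rule closure_of_subset) (auto simp: mem)
  moreover have "range (\<lambda>j. T (?b j)) \<subseteq> ?B"
    using b Nb by blast
  ultimately have sub: "range (\<lambda>j. T (?b j)) \<subseteq> ms.mtopology closure_of ?B"
    by blast
  have "compactin ms.mtopology (ms.mtopology closure_of ?B)"
    using compact by (simp add: compact_operator_def norm_topology_def)
  then obtain l and r :: "nat \<Rightarrow> nat" where lr: "strict_mono r"
      "limitin ms.mtopology ((\<lambda>j. T (?b j)) \<circ> r) l sequentially"
    using sub unfolding ms.compactin_sequentially by blast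
  then have l: "l \<in> X" and lim: "(\<lambda>j. N (\<lambda>z. T (?b (r j)) z - l z)) \<longlonglongrightarrow> 0"
    unfolding ms.limitin_metric_dist_null by (auto simp: o_def)
  show thesis
  proof (rule that)
    show "(\<lambda>z. of_real M' * l z) \<in> X" by (rule scale_mem[OF l])
    show "strict_mono r" by fact
    have "N (\<lambda>z. T (f (r j)) z - of_real M' * l z) = M' * N (\<lambda>z. T (?b (r j)) z - l z)" for j
    proof -
      have "(\<lambda>z. T (f (r j)) z - of_real M' * l z) = (\<lambda>z. of_real M' * (T (?b (r j)) z - l z))"
        unfolding map_scale[OF f] using M' by (auto simp: algebra_simps)
      then show ?thesis
        using norm_scale[OF diff_mem[OF mem[OF b] l], of "of_real M'" "r j"] M' by simp
    qed
    then show "(\<lambda>j. N (\<lambda>z. T (f (r j)) z - of_real M' * l z)) \<longlonglongrightarrow> 0"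
      using tendsto_mult_left[OF lim, of M'] by simp
  qed
qed

text \<open>Images staying away from 0 in norm along a subsequence would, by compactness, have a
  further subsequence converging in norm. Evaluations being continuous, its limit is the pointwise
  limit 0, a contradiction.\<close>

lemma pointwise_null_imp_norm_null:
  assumes f: "\<And>j. f j \<in> X" and M: "\<And>j. N (f j) \<le> M"
    and null: "\<And>z. (\<lambda>j. T (f j) z) \<longlonglongrightarrow> 0"
  shows "(\<lambda>j. N (T (f j))) \<longlonglongrightarrow> 0"
proof (rule ccontr)
  assume "\<not> ?thesis"
  then obtain e where e: "e > 0" "\<not> (\<forall>\<^sub>F j in sequentially. N (T (f j)) < e)"
    using norm_nonneg by (auto simp: tendsto_iff dist_real_def)
  then have "\<exists>\<^sub>F j in sequentially. e \<le> N (T (f j))"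
    by (simp add: frequently_def not_le)
  then have "infinite {j. e \<le> N (T (f j))}"
    by (simp add: cofinite_eq_sequentially[symmetric] frequently_cofinite)
  then obtain s :: "nat \<Rightarrow> nat" where s: "strict_mono s" "\<And>j. e \<le> N (T (f (s j)))"
    using infinite_enumerate by blast
  obtain g and r :: "nat \<Rightarrow> nat" where g: "g \<in> X" "strict_mono r"
    "(\<lambda>j. N (\<lambda>z. T (f (s (r j))) z - g z)) \<longlonglongrightarrow> 0"
    using compact_subseq[of "\<lambda>j. f (s j)" M] f M by blast
  have "g z = 0" for z
  proof (rule LIMSEQ_unique)
    show "(\<lambda>j. T (f (s (r j))) z) \<longlonglongrightarrow> g z"
      by (rule pointwise_limit[OF mem[OF f] g(1,3)])
    show "(\<lambda>j. T (f (s (r j))) z) \<longlonglongrightarrow> 0"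
      using LIMSEQ_subseq_LIMSEQ[OF null[of z] strict_mono_o[OF s(1) g(2)]]
      by (simp add: o_def)
  qed
  then have "(\<lambda>j. N (T (f (s (r j))))) \<longlonglongrightarrow> 0"
    using g(3) by simp
  moreover have "\<And>j. e \<le> N (T (f (s (r j))))" using s(2) by blast
  ultimately have "e \<le> 0" by (meson LIMSEQ_le_const)
  with e show False by simp
qed

lemma cesaro_mean_mem: "f \<in> X \<Longrightarrow> cesaro_mean T n f \<in> X"
  unfolding cesaro_mean_def
  by (intro scale_mem sum_mem_norm[THEN conjunct1]) (auto simp: pow_mem)

lemma cesaro_mean_diff: "f \<in> X \<Longrightarrow> g \<in> X \<Longrightarrow>
  cesaro_mean T n (\<lambda>z. f z - g z) = (\<lambda>z. cesaro_mean T n f z - cesaro_mean T n g z)"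
  by (auto simp: cesaro_mean_def pow_diff sum_subtractf algebra_simps)

lemma cesaro_mean_scale: "f \<in> X \<Longrightarrow>
  cesaro_mean T n (\<lambda>z. c * f z) = (\<lambda>z. c * cesaro_mean T n f z)"
  by (auto simp: cesaro_mean_def pow_scale sum_distrib_left algebra_simps)

lemma norm_cesaro_mean_le:
  assumes "f \<in> X"
  shows "N (cesaro_mean T n f) \<le> (1 / real n) * (\<Sum>m=1..n. N ((T ^^ m) f))"
proof -
  have *: "(\<lambda>z. \<Sum>m=1..n. (T ^^ m) f z) \<in> X"
    "N (\<lambda>z. \<Sum>m=1..n. (T ^^ m) f z) \<le> (\<Sum>m=1..n. N ((T ^^ m) f))"
    using sum_mem_norm[of "{1..n}" "\<lambda>m. (T ^^ m) f"] assms by (auto simp: pow_mem)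
  have "N (cesaro_mean T n f) = (1 / real n) * N (\<lambda>z. \<Sum>m=1..n. (T ^^ m) f z)"
    unfolding cesaro_mean_def norm_scale[OF *(1)] by (simp add: norm_divide)
  also have "\<dots> \<le> (1 / real n) * (\<Sum>m=1..n. N ((T ^^ m) f))"
    by (intro mult_left_mono *(2)) auto
  finally show ?thesis .
qed

section \<open>Uniform decay on a hyperplane and mean ergodicity\<close>

text \<open>The hypothesis couples the power with the index of the sequence. Near-maximisers of the
  \<open>m\<close>-th power on the unit ball of the hyperplane form one such sequence, so decay
  along it is decay uniformly on the ball.\<close>

lemma decay_if_pointwise:
  assumes null: "\<And>f z. (\<And>j. f j \<in> X) \<Longrightarrow> (\<And>j. f j z0 = 0) \<Longrightarrow> (\<And>j. N (f j) \<le> 1)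
    \<Longrightarrow> (\<lambda>j. (T ^^ j) (f j) z) \<longlonglongrightarrow> 0"
  obtains \<delta> where "\<delta> \<longlonglongrightarrow> 0"
    "\<And>m f. f \<in> X \<Longrightarrow> f z0 = 0 \<Longrightarrow> N ((T ^^ m) f) \<le> \<delta> m * N f"
proof -
  obtain M where M: "0 \<le> M" "\<And>n f. f \<in> X \<Longrightarrow> N ((T ^^ n) f) \<le> M * N f"
    using power_boundE by blast
  define B where "B = {f \<in> X. f z0 = 0 \<and> N f \<le> 1}"
  define \<delta> where "\<delta> m = (SUP f\<in>B. N ((T ^^ m) f))" for m
  have ne: "B \<noteq> {}" using zero_mem norm_zero_fun by (auto simp: B_def)
  have MB: "N ((T ^^ m) f) \<le> M" if "f \<in> B" for m f
    using M(2)[of f m] mult_left_mono[of "N f" 1 M] that M(1) by (auto simp: B_def)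
  have bdd: "bdd_above ((\<lambda>f. N ((T ^^ m) f)) ` B)" for m
    by (rule bdd_aboveI2[of _ _ M]) (rule MB)
  have le: "N ((T ^^ m) f) \<le> \<delta> m" if "f \<in> B" for m f
    unfolding \<delta>_def by (rule cSUP_upper[OF that bdd])
  have "0 \<le> \<delta> m" for m
    using le ne norm_nonneg by (metis all_not_in_conv order_trans)
  \<comment> \<open>The supremum need not be attained; the slack \<open>1 / real (Suc m)\<close>
    vanishes in the limit.\<close>
  have "\<exists>f\<in>B. \<delta> m - 1 / real (Suc m) < N ((T ^^ m) f)" for m
    using less_cSUP_iff[OF ne bdd[of m], of "\<delta> m - 1 / real (Suc m)"] by (simp add: \<delta>_def)
  then obtain F where F: "\<And>m. F m \<in> B" "\<And>m. \<delta> m - 1 / real (Suc m) < N ((T ^^ m) (F m))"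
    by metis
  have FX: "F m \<in> X" "F m z0 = 0" "N (F m) \<le> 1" for m using F(1)[of m] by (auto simp: B_def)
  \<comment> \<open>Compactness acts through the outermost factor: \<open>T ^^ Suc m\<close> is
    \<open>T\<close> applied to the bounded sequence \<open>(T ^^ m) (F (Suc m))\<close>. The index
    shift is undone by \<open>LIMSEQ_imp_Suc\<close>.\<close>
  have "(\<lambda>m. N (T ((T ^^ m) (F (Suc m))))) \<longlonglongrightarrow> 0"
  proof (rule pointwise_null_imp_norm_null)
    show "(T ^^ m) (F (Suc m)) \<in> X" for m by (rule pow_mem[OF FX(1)])
    show "N ((T ^^ m) (F (Suc m))) \<le> M" for m by (rule MB[OF F(1)])
    show "(\<lambda>m. T ((T ^^ m) (F (Suc m))) z) \<longlonglongrightarrow> 0" for z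
      using LIMSEQ_Suc[OF null[of F z]] FX by simp
  qed
  then have "(\<lambda>m. N ((T ^^ Suc m) (F (Suc m)))) \<longlonglongrightarrow> 0"
    by simp
  then have "(\<lambda>m. N ((T ^^ m) (F m))) \<longlonglongrightarrow> 0"
    by (rule LIMSEQ_imp_Suc)
  then have "(\<lambda>m. N ((T ^^ m) (F m)) + 1 / real (Suc m)) \<longlonglongrightarrow> 0 + 0"
    by (intro tendsto_add LIMSEQ_Suc lim_1_over_n)
  then have lim: "(\<lambda>m. N ((T ^^ m) (F m)) + 1 / real (Suc m)) \<longlonglongrightarrow> 0" by simp
  show thesis
  proof (rule that)
    show "\<delta> \<longlonglongrightarrow> 0"
    proof (rule tendsto_sandwich[OF _ _ tendsto_const lim])
      show "\<forall>\<^sub>F m in sequentially. \<delta> m \<le> N ((T ^^ m) (F m)) + 1 / real (Suc m)"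
        using F(2) by (intro always_eventually allI) (simp add: less_imp_le diff_less_eq)
    qed (simp add: \<open>\<And>m. 0 \<le> \<delta> m\<close>)
    fix m f assume f: "f \<in> X" "f z0 = 0"
    show "N ((T ^^ m) f) \<le> \<delta> m * N f"
    proof (cases "N f = 0")
      case True
      then show ?thesis using M(2)[OF f(1), of m] by simp
    next
      case False
      then have pos: "N f > 0" using norm_nonneg[of f] by simp
      let ?g = "\<lambda>z. of_real (1 / N f) * f z"
      have "?g \<in> X" by (rule scale_mem[OF f(1)])
      moreover have "N ?g = 1" using norm_scale[OF f(1), of "of_real (1 / N f)"] pos
        by (simp add: norm_divide)
      ultimately have "N ((T ^^ m) ?g) \<le> \<delta> m" using le f(2) by (simp add: B_def)
      moreover have "N ((T ^^ m) ?g) = (1 / N f) * N ((T ^^ m) f)"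
        unfolding pow_scale[OF f(1)] using norm_scale[OF pow_mem[OF f(1)], of "of_real (1 / N f)" m] pos
        by (simp add: norm_divide)
      ultimately have "(1 / N f) * N ((T ^^ m) f) \<le> \<delta> m" by metis
      then show ?thesis using pos by (simp add: pos_divide_le_eq)
    qed
  qed
qed

text \<open>Splits \<open>f\<close> into \<open>f - f z0 * e\<close> and \<open>f z0 * e\<close>:
  the first part vanishes at \<open>z0\<close>, so its means decay, and the second reduces to the
  means of \<open>e\<close>. The limit operator has rank at most one.\<close>

lemma uniformly_mean_ergodicI:
  assumes \<delta>: "\<delta> \<longlonglongrightarrow> 0"
    and decay: "\<And>m f. f \<in> X \<Longrightarrow> f z0 = 0 \<Longrightarrow> N ((T ^^ m) f) \<le> \<delta> m * N f"
    and e: "e \<in> X" "e z0 = 1" and q: "q \<in> X"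
    and lim: "(\<lambda>n. N (\<lambda>z. cesaro_mean T n e z - q z)) \<longlonglongrightarrow> 0"
  shows "uniformly_mean_ergodic X N T"
proof -
  obtain L where L: "0 \<le> L" "\<And>f. f \<in> X \<Longrightarrow> cmod (f z0) \<le> L * N f"
    using eval_boundE by blast
  define P where "P = (\<lambda>(f::cfun) z. f z0 * q z)"
  have P: "bounded_operator X N P"
    unfolding bounded_operator_def
  proof (intro conjI exI ballI allI)
    fix f g assume f: "f \<in> X"
    show "P f \<in> X" unfolding P_def by (rule scale_mem[OF q])
    have "N (P f) = cmod (f z0) * N q" unfolding P_def by (rule norm_scale[OF q])
    also have "\<dots> \<le> L * N f * N q" by (intro mult_right_mono L(2) f norm_nonneg)
    finally show "N (P f) \<le> (L * N q) * N f" by (simp add: algebra_simps)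
  qed (auto simp: P_def algebra_simps)
  define \<gamma> where "\<gamma> n = (1 / real n) * (\<Sum>m=1..n. \<delta> m)" for n
  have \<gamma>: "\<gamma> \<longlonglongrightarrow> 0" unfolding \<gamma>_def by (rule cesaro_mean_null[OF \<delta>])
  \<comment> \<open>For \<open>N f \<le> 1\<close>, \<open>L\<close> bounds
    \<open>cmod (f z0)\<close> and \<open>1 + L * N e\<close> bounds the norm of
    \<open>f - f z0 * e\<close>. The absolute value is there because no sign of
    \<open>\<delta>\<close>, hence of \<open>\<gamma>\<close>, is assumed.\<close>
  define \<rho> where "\<rho> n = \<bar>\<gamma> n\<bar> * (1 + L * N e) + L * N (\<lambda>z. cesaro_mean T n e z - q z)" for n
  have \<rho>: "\<rho> \<longlonglongrightarrow> 0"
    unfolding \<rho>_def using \<gamma> lim by (auto intro!: tendsto_eq_intros)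
  have bound: "N (\<lambda>z. cesaro_mean T n f z - P f z) \<le> \<rho> n" if f: "f \<in> X" "N f \<le> 1" for n f
  proof -
    let ?f0 = "\<lambda>z. f z - f z0 * e z"
    have f0: "?f0 \<in> X" by (intro diff_mem scale_mem f e)
    have Lf: "cmod (f z0) \<le> L"
      using L(2)[OF f(1)] mult_left_mono[OF f(2) L(1)] by simp
    have "N (\<lambda>z. f z0 * e z) \<le> L * N e"
      unfolding norm_scale[OF e(1)] by (intro mult_right_mono Lf norm_nonneg)
    then have Nf0: "N ?f0 \<le> 1 + L * N e"
      using norm_diff[OF f(1) scale_mem[OF e(1), of "f z0"]] f(2) by linarith
    have "N (cesaro_mean T n ?f0) \<le> (1 / real n) * (\<Sum>m=1..n. \<delta> m * N ?f0)"
      using norm_cesaro_mean_le[OF f0, of n] decay[OF f0] e(2)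
      by (elim order_trans) (intro mult_left_mono sum_mono, auto)
    also have "\<dots> = \<gamma> n * N ?f0" by (simp add: \<gamma>_def sum_distrib_right mult.assoc)
    also have "\<dots> \<le> \<bar>\<gamma> n\<bar> * (1 + L * N e)"
      by (intro mult_mono Nf0 norm_nonneg) auto
    finally have 1: "N (cesaro_mean T n ?f0) \<le> \<bar>\<gamma> n\<bar> * (1 + L * N e)" .
    let ?d = "\<lambda>z. cesaro_mean T n e z - q z"
    have d: "?d \<in> X" by (intro diff_mem cesaro_mean_mem e q)
    have 2: "N (\<lambda>z. f z0 * ?d z) \<le> L * N ?d"
      unfolding norm_scale[OF d] by (intro mult_right_mono Lf norm_nonneg)
    have "(\<lambda>z. cesaro_mean T n f z - P f z) = (\<lambda>z. cesaro_mean T n ?f0 z + f z0 * ?d z)"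
      unfolding cesaro_mean_diff[OF f(1) scale_mem[OF e(1)]] cesaro_mean_scale[OF e(1)] P_def
      by (auto simp: algebra_simps)
    then have "N (\<lambda>z. cesaro_mean T n f z - P f z) \<le> N (cesaro_mean T n ?f0) + N (\<lambda>z. f z0 * ?d z)"
      using norm_add[OF cesaro_mean_mem[OF f0] scale_mem[OF d]] by simp
    with 1 2 show ?thesis by (simp add: \<rho>_def)
  qed
  have "(\<lambda>n. operator_norm X N (\<lambda>f z. cesaro_mean T n f z - P f z)) \<longlonglongrightarrow> 0"
  proof (rule tendsto_sandwich[OF _ _ tendsto_const \<rho>])
    show "\<forall>\<^sub>F n in sequentially. operator_norm X N (\<lambda>f z. cesaro_mean T n f z - P f z) \<le> \<rho> n"
      unfolding operator_norm_def using bound zero_mem norm_zero_fun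
      by (intro always_eventually allI cSUP_least) auto
    show "\<forall>\<^sub>F n in sequentially. 0 \<le> operator_norm X N (\<lambda>f z. cesaro_mean T n f z - P f z)"
    proof (intro always_eventually allI)
      fix n
      \<comment> \<open>The zero function lies in the unit ball, so its nonnegative value is a lower
        bound for the supremum once the set is known to be bounded above.\<close>
      have "N (\<lambda>z. cesaro_mean T n (\<lambda>z. 0) z - P (\<lambda>z. 0) z)
        \<le> operator_norm X N (\<lambda>f z. cesaro_mean T n f z - P f z)"
        unfolding operator_norm_def
      proof (rule cSUP_upper)
        show "bdd_above ((\<lambda>f. N (\<lambda>z. cesaro_mean T n f z - P f z)) ` {f \<in> X. N f \<le> 1})"
          by (rule bdd_aboveI2[of _ _ "\<rho> n"]) (use bound in auto)
      qed (auto simp: zero_mem norm_zero_fun)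
      then show "0 \<le> operator_norm X N (\<lambda>f z. cesaro_mean T n f z - P f z)"
        using norm_nonneg order_trans by blast
    qed
  qed
  then show ?thesis
    unfolding uniformly_mean_ergodic_def cesaro_mean_def using bounded P by blast
qed

text \<open>
  With \<open>\<lambda> = T 1 z0\<close>, both \<open>T 1 - \<lambda>\<close> and \<open>T 1 - 1\<close> have means tending to 0: the former by the
  decay on functions vanishing at \<open>z0\<close>, the latter by telescoping. If \<open>\<lambda> \<noteq> 1\<close> the means of 1
  therefore tend to 0; if \<open>\<lambda> = 1\<close> a limit point of \<open>T ^^ n 1\<close> is a fixed point not vanishing
  at \<open>z0\<close>.
\<close>

lemma uniformly_mean_ergodic_if_decay:
  assumes \<delta>: "\<delta> \<longlonglongrightarrow> 0"
    and decay: "\<And>m f. f \<in> X \<Longrightarrow> f z0 = 0 \<Longrightarrow> N ((T ^^ m) f) \<le> \<delta> m * N f"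
    and eval: "\<And>f. f \<in> X \<Longrightarrow> T f z0 = T (\<lambda>z. 1) z0 * f z0"
  shows "uniformly_mean_ergodic X N T"
proof (cases "T (\<lambda>z. 1) z0 = 1")
  case False
  define \<mu> where "\<mu> = T (\<lambda>z. 1) z0"
  obtain M where M: "0 \<le> M" "\<And>n f. f \<in> X \<Longrightarrow> N ((T ^^ n) f) \<le> M * N f"
    using power_boundE by blast
  let ?i = "\<lambda>z::complex. 1::complex"
  let ?g = "\<lambda>z. T ?i z - \<mu> * ?i z"
  have g: "?g \<in> X" by (intro diff_mem mem scale_mem one_mem)
  define \<gamma> where "\<gamma> n = (1 / real n) * (\<Sum>m=1..n. \<delta> m)" for n
  have \<gamma>: "\<gamma> \<longlonglongrightarrow> 0" unfolding \<gamma>_def by (rule cesaro_mean_null[OF \<delta>])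
  have 1: "N (cesaro_mean T n ?g) \<le> \<gamma> n * N ?g" for n
  proof -
    have "N (cesaro_mean T n ?g) \<le> (1 / real n) * (\<Sum>m=1..n. \<delta> m * N ?g)"
      using norm_cesaro_mean_le[OF g, of n] decay[OF g]
      by (elim order_trans) (intro mult_left_mono sum_mono, auto simp: \<mu>_def)
    then show ?thesis by (simp add: \<gamma>_def sum_distrib_right mult.assoc)
  qed
  have 2: "N (\<lambda>z. cesaro_mean T n (T ?i) z - cesaro_mean T n ?i z) \<le> (1 / real n) * (2 * M * N ?i)"
    if "n > 0" for n
  proof -
    have telescope: "(\<Sum>m=1..n. (T ^^ m) (T ?i) z) - (\<Sum>m=1..n. (T ^^ m) ?i z)
        = (T ^^ Suc n) ?i z - (T ^^ 1) ?i z" for z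
      using sum_Suc_diff[of 1 n "\<lambda>m. (T ^^ m) ?i z"]
      by (simp add: sum_subtractf funpow_swap1)
    have eq: "(\<lambda>z. cesaro_mean T n (T ?i) z - cesaro_mean T n ?i z)
        = (\<lambda>z. (1 / of_nat n) * ((T ^^ Suc n) ?i z - (T ^^ 1) ?i z))"
      unfolding cesaro_mean_def right_diff_distrib[symmetric] telescope ..
    have "N (\<lambda>z. (T ^^ Suc n) ?i z - (T ^^ 1) ?i z) \<le> N ((T ^^ Suc n) ?i) + N ((T ^^ 1) ?i)"
      by (intro norm_diff pow_mem one_mem)
    also have "\<dots> \<le> M * N ?i + M * N ?i"
      by (intro add_mono M one_mem)
    finally show ?thesis
      unfolding eq norm_scale[OF diff_mem[OF pow_mem[OF one_mem] pow_mem[OF one_mem]]]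
      by (simp add: norm_divide divide_right_mono)
  qed
  show ?thesis
  proof (rule uniformly_mean_ergodicI[OF \<delta> decay one_mem refl zero_mem])
    define \<rho> where "\<rho> n = (\<gamma> n * N ?g + (1 / real n) * (2 * M * N ?i)) / cmod (1 - \<mu>)" for n
    have "\<rho> \<longlonglongrightarrow> (0 * N ?g + 0 * (2 * M * N ?i)) / cmod (1 - \<mu>)"
      unfolding \<rho>_def using False by (intro tendsto_intros \<gamma> lim_1_over_n) (auto simp: \<mu>_def)
    then have \<rho>: "\<rho> \<longlonglongrightarrow> 0" by simp
    have "N (cesaro_mean T n ?i) \<le> \<rho> n" if "n > 0" for n
    proof -
      have "(\<lambda>z. (1 - \<mu>) * cesaro_mean T n ?i z)
        = (\<lambda>z. cesaro_mean T n ?g z - (cesaro_mean T n (T ?i) z - cesaro_mean T n ?i z))"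
        unfolding cesaro_mean_diff[OF mem[OF one_mem] scale_mem[OF one_mem]] cesaro_mean_scale[OF one_mem]
        by (auto simp: algebra_simps)
      then have "cmod (1 - \<mu>) * N (cesaro_mean T n ?i)
        \<le> N (cesaro_mean T n ?g) + N (\<lambda>z. cesaro_mean T n (T ?i) z - cesaro_mean T n ?i z)"
        using norm_diff[OF cesaro_mean_mem[OF g] diff_mem[OF cesaro_mean_mem[OF mem[OF one_mem]]
            cesaro_mean_mem[OF one_mem]], of n n n]
          norm_scale[OF cesaro_mean_mem[OF one_mem], of "1 - \<mu>" n] by simp
      also have "\<dots> \<le> \<gamma> n * N ?g + (1 / real n) * (2 * M * N ?i)"
        by (intro add_mono 1 2 that)
      finally show ?thesis using False by (simp add: \<rho>_def \<mu>_def pos_le_divide_eq mult.commute)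
    qed
    then have upper: "\<forall>\<^sub>F n in sequentially. N (cesaro_mean T n ?i) \<le> \<rho> n"
      unfolding eventually_sequentially by (metis Suc_le_lessD)
    have "(\<lambda>n. N (cesaro_mean T n ?i)) \<longlonglongrightarrow> 0"
      by (rule tendsto_sandwich[OF always_eventually upper tendsto_const \<rho>])
        (simp add: norm_nonneg)
    then show "(\<lambda>n. N (\<lambda>z. cesaro_mean T n ?i z - 0)) \<longlonglongrightarrow> 0"
      by simp
  qed
next
  case True
  obtain M where M: "0 \<le> M" "\<And>n f. f \<in> X \<Longrightarrow> N ((T ^^ n) f) \<le> M * N f"
    using power_boundE by blast
  let ?i = "\<lambda>z::complex. 1::complex"
  define S where "S n = (T ^^ n) ?i" for n
  have S: "S n \<in> X" for n unfolding S_def by (rule pow_mem[OF one_mem])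
  have TS: "T (S n) = S (Suc n)" for n by (simp add: S_def)
  have Sz0: "S n z0 = 1" for n
  proof (induction n)
    case (Suc n)
    then show ?case using eval[OF S[of n]] True by (simp add: TS)
  qed (simp add: S_def)
  have step: "(\<lambda>n. N (\<lambda>z. S (Suc n) z - S n z)) \<longlonglongrightarrow> 0"
  proof (rule tendsto_sandwich[OF _ _ tendsto_const])
    let ?d = "\<lambda>z. T ?i z - ?i z"
    have d: "?d \<in> X" by (intro diff_mem mem one_mem)
    \<comment> \<open>\<open>T 1 - 1\<close> vanishes at \<open>z0\<close> because
      \<open>T 1 z0 = 1\<close>, so its iterates, which are the increments of \<open>S\<close>,
      inherit the decay.\<close>
    have "(\<lambda>z. S (Suc n) z - S n z) = (T ^^ n) ?d" for n
      unfolding pow_diff[OF mem[OF one_mem] one_mem] by (simp add: S_def funpow_swap1)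
    then show "\<forall>\<^sub>F n in sequentially. N (\<lambda>z. S (Suc n) z - S n z) \<le> \<delta> n * N ?d"
      using decay[OF d] True by simp
    show "(\<lambda>n. \<delta> n * N ?d) \<longlonglongrightarrow> 0"
      using tendsto_mult_right[OF \<delta>, of "N ?d"] by simp
  qed (simp add: norm_nonneg)
  obtain h and r :: "nat \<Rightarrow> nat" where h: "h \<in> X" "strict_mono r"
    and lim': "(\<lambda>j. N (\<lambda>z. T (S (r j)) z - h z)) \<longlonglongrightarrow> 0"
  proof (rule compact_subseq)
    show "S j \<in> X" "N (S j) \<le> M * N ?i" for j
      using S M(2)[OF one_mem, of j] by (auto simp: S_def)
  qed
  note lim = lim'[unfolded TS]
  have hz0: "h z0 = 1"
    using pointwise_limit[OF S h(1) lim, of z0] Sz0 by (simp add: LIMSEQ_const_iff)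
  \<comment> \<open>\<open>T h - h\<close> is an increment of \<open>S\<close> plus the error
    \<open>S (Suc (r j)) - h\<close> minus the image of that error; each of the three has norm
    tending to 0 in \<open>j\<close>.\<close>
  have "N (\<lambda>z. T h z - h z) \<le> 0"
  proof (rule LIMSEQ_le_const)
    let ?a = "\<lambda>j. N (\<lambda>z. S (Suc (r j)) z - h z)" and ?b = "\<lambda>j. N (\<lambda>z. S (Suc (Suc (r j))) z - S (Suc (r j)) z)"
    have b: "?b \<longlonglongrightarrow> 0"
      using LIMSEQ_subseq_LIMSEQ[OF LIMSEQ_Suc[OF step] h(2)] by (simp add: o_def)
    have "(\<lambda>j. M * ?a j + (?b j + ?a j)) \<longlonglongrightarrow> M * 0 + (0 + 0)"
      by (intro tendsto_intros lim b)
    then show "(\<lambda>j. M * ?a j + (?b j + ?a j)) \<longlonglongrightarrow> 0" by simp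
    have "N (\<lambda>z. T h z - h z) \<le> M * ?a j + (?b j + ?a j)" for j
    proof -
      let ?A = "\<lambda>z. S (Suc (r j)) z - h z" and ?B = "\<lambda>z. S (Suc (Suc (r j))) z - S (Suc (r j)) z"
      have A: "?A \<in> X" and B: "?B \<in> X" by (intro diff_mem S h)+
      have "T ?A = (\<lambda>z. S (Suc (Suc (r j))) z - T h z)"
        unfolding map_diff[OF S h(1)] TS ..
      then have eq: "(\<lambda>z. T h z - h z) = (\<lambda>z. (?B z + ?A z) - T ?A z)"
        by (auto simp: algebra_simps)
      have "N (\<lambda>z. T h z - h z) \<le> (N ?B + N ?A) + N (T ?A)"
        unfolding eq using norm_diff[OF add_mem[OF B A] mem[OF A]] norm_add[OF B A] by linarith
      then show ?thesis using M(2)[OF A, of 1] by simp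
    qed
    then show "\<exists>n. \<forall>j\<ge>n. N (\<lambda>z. T h z - h z) \<le> M * ?a j + (?b j + ?a j)" by blast
  qed
  then have "N (\<lambda>z. T h z - h z) = 0" using norm_nonneg antisym by blast
  then have Th: "T h = h"
    using Metric_space.zero[OF metric mem[OF h(1)] h(1)] by simp
  have "(T ^^ m) h = h" for m by (induction m) (auto simp: Th)
  \<comment> \<open>At \<open>n = 0\<close> the mean is the zero function, so the equality holds
    only eventually.\<close>
  then have "cesaro_mean T n h = h" if "n > 0" for n
    using that by (simp add: cesaro_mean_def)
  then have "\<forall>\<^sub>F n in sequentially. N (\<lambda>z. cesaro_mean T n h z - h z) = 0"
    unfolding eventually_sequentially by (intro exI[of _ 1]) (simp add: norm_zero_fun)
  then have mean_lim: "(\<lambda>n. N (\<lambda>z. cesaro_mean T n h z - h z)) \<longlonglongrightarrow> 0"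
    by (rule tendsto_eventually)
  show ?thesis
    by (rule uniformly_mean_ergodicI[OF \<delta> decay h(1) hz0 h(1) mean_lim])
qed

end

section \<open>Weighted composition operators\<close>

text \<open>
  A form of the Borel--Caratheodory inequality: the Schwarz lemma is applied to
  \<open>G / (2 * B - G)\<close>, where \<open>G\<close> is \<open>F\<close> rescaled to the unit disc and normalised to vanish at 0.
\<close>

lemma entire_bound_by_real_part:
  assumes F: "F holomorphic_on UNIV" and R: "0 < R"
    and A: "\<And>z. cmod z < R \<Longrightarrow> Re (F z) \<le> A" and z: "cmod z \<le> R / 2"
  shows "cmod (F z) \<le> 2 * A + 3 * cmod (F 0) + 2"
proof -
  \<comment> \<open>The extra 1 makes \<open>Re (G \<xi>) < B\<close> strict and \<open>B\<close>
    positive, so that \<open>2 * B - G\<close> has no zero in the disc.\<close>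
  define B where "B = A - Re (F 0) + 1"
  define G where "G \<xi> = F (of_real R * \<xi>) - F 0" for \<xi>
  have ReG: "Re (G \<xi>) < B" if "cmod \<xi> < 1" for \<xi>
    using A[of "of_real R * \<xi>"] that R by (simp add: G_def B_def norm_mult)
  have B: "0 < B" using ReG[of 0] by (simp add: G_def)
  have nz: "2 * of_real B - G \<xi> \<noteq> 0" if "cmod \<xi> < 1" for \<xi>
  proof
    assume "2 * of_real B - G \<xi> = 0"
    then have "Re (2 * of_real B - G \<xi>) = 0" by simp
    then show False using ReG[OF that] B by simp
  qed
  have holG: "G holomorphic_on UNIV"
    unfolding G_def by (intro holomorphic_intros holomorphic_on_compose_gen[OF _ F, unfolded o_def]) auto
  let ?\<phi> = "\<lambda>\<xi>. G \<xi> / (2 * of_real B - G \<xi>)"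
  have "cmod (?\<phi> \<xi>) < 1" if "cmod \<xi> < 1" for \<xi>
  proof -
    have "(cmod (G \<xi>))\<^sup>2 < (cmod (2 * of_real B - G \<xi>))\<^sup>2"
    proof -
      \<comment> \<open>This is the difference |2 B - G|^2 - |G|^2.\<close>
      have "0 < 4 * B * (B - Re (G \<xi>))" using ReG[OF that] B by simp
      then show ?thesis unfolding cmod_power2 by (simp add: power2_eq_square algebra_simps)
    qed
    then have "cmod (G \<xi>) < cmod (2 * of_real B - G \<xi>)" by (rule power_less_imp_less_base) simp
    then show ?thesis using nz[OF that] by (simp add: norm_divide divide_less_eq)
  qed
  moreover have "?\<phi> holomorphic_on ball 0 1"
    using nz by (intro holomorphic_intros holomorphic_on_subset[OF holG]) auto
  moreover have "?\<phi> 0 = 0" by (simp add: G_def)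
  ultimately have Schwarz: "cmod (?\<phi> \<xi>) \<le> cmod \<xi>" if "cmod \<xi> < 1" for \<xi>
    using Schwarz_Lemma(1)[of ?\<phi>] that by blast
  define \<xi> where "\<xi> = z / of_real R"
  have \<xi>: "cmod \<xi> \<le> 1 / 2" using z R by (simp add: \<xi>_def norm_divide field_simps)
  then have "cmod (?\<phi> \<xi>) \<le> 1 / 2" using Schwarz[of \<xi>] by linarith
  \<comment> \<open>At half the radius the Schwarz bound gives |G| \<le> B + |G| / 2, and the
    modulus of \<open>G\<close> on the right is absorbed.\<close>
  then have "cmod (G \<xi>) \<le> (1 / 2) * cmod (2 * of_real B - G \<xi>)"
    using nz[of \<xi>] \<xi> by (simp add: norm_divide pos_divide_le_eq)
  also have "\<dots> \<le> (1 / 2) * (2 * B + cmod (G \<xi>))"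
    using norm_triangle_ineq4[of "2 * of_real B" "G \<xi>"] B by (simp add: norm_mult)
  finally have "cmod (G \<xi>) \<le> 2 * B" by simp
  then have "cmod (F z) \<le> 2 * B + cmod (F 0)"
    using R norm_triangle_ineq2[of "F z" "F 0"] by (simp add: G_def \<xi>_def)
  then show ?thesis using abs_Re_le_cmod[of "F 0"] by (simp add: B_def)
qed

text \<open>
  With \<open>u = exp g\<close>, the growth condition bounds the real part of the entire function
  \<open>g + w * \<psi>\<close> by a quadratic in \<open>z\<close> and \<open>w\<close>, for every constant \<open>w\<close>; hence it bounds the
  modulus. Taking \<open>\<bar>w\<bar>\<close> comparable to \<open>\<bar>z\<bar>\<close> gives linear growth of \<open>\<psi>\<close>.
\<close>

lemma affine_if_weighted_growth:
  assumes u: "u holomorphic_on UNIV" and \<psi>: "\<psi> holomorphic_on UNIV" and nz: "\<And>z. u z \<noteq> 0"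
    and growth: "\<And>z. cmod (u z) * exp ((cmod (\<psi> z))\<^sup>2 / 2) \<le> C * exp ((cmod z)\<^sup>2 / 2)"
  obtains a b where "\<And>z. \<psi> z = a * z + b"
proof -
  obtain g where g: "g holomorphic_on UNIV" "\<And>z. exp (g z) = u z"
    using holomorphic_logarithm_exists[of UNIV u 0] u nz by auto
  have "0 < cmod (u 0) * exp ((cmod (\<psi> 0))\<^sup>2 / 2)" using nz by simp
  also have "\<dots> \<le> C" using growth[of 0] by simp
  finally have C: "0 < C" .
  have re: "Re (g z + w * \<psi> z) \<le> ln C + ((cmod z)\<^sup>2 + (cmod w)\<^sup>2) / 2" for z w
  proof -
    have "exp (Re (g z) + (cmod (\<psi> z))\<^sup>2 / 2) \<le> exp (ln C + (cmod z)\<^sup>2 / 2)"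
      using growth[of z] C by (simp add: exp_add flip: g(2))
    then have "Re (g z) + (cmod (\<psi> z))\<^sup>2 / 2 \<le> ln C + (cmod z)\<^sup>2 / 2" by simp
    moreover have "Re (w * \<psi> z) \<le> ((cmod w)\<^sup>2 + (cmod (\<psi> z))\<^sup>2) / 2"
      using complex_Re_le_cmod[of "w * \<psi> z"] sum_squares_bound[of "cmod w" "cmod (\<psi> z)"]
      by (simp add: norm_mult del: times_complex.simps)
    moreover have "Re (g z + w * \<psi> z) = Re (g z) + Re (w * \<psi> z)" by simp
    ultimately show ?thesis by argo
  qed
  \<comment> \<open>The real part is at most quadratic on the disc of radius \<open>R\<close>, so
    the inequality above bounds the modulus on half that disc.\<close>
  have bound: "cmod (g z + w * \<psi> z) \<le> 2 * \<bar>ln C\<bar> + R\<^sup>2 + (cmod w)\<^sup>2 + 3 * (cmod (g 0) + cmod w * cmod (\<psi> 0)) + 2"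
    if "0 < R" "cmod z \<le> R / 2" for z w R
  proof -
    have "cmod (g z + w * \<psi> z) \<le> 2 * (ln C + (R\<^sup>2 + (cmod w)\<^sup>2) / 2) + 3 * cmod (g 0 + w * \<psi> 0) + 2"
    proof (rule entire_bound_by_real_part[of "\<lambda>z. g z + w * \<psi> z", OF _ that(1) _ that(2)])
      show "(\<lambda>z. g z + w * \<psi> z) holomorphic_on UNIV" by (intro holomorphic_intros g \<psi>)
      fix x assume "cmod x < R"
      then have "(cmod x)\<^sup>2 \<le> R\<^sup>2" by (intro power_mono) auto
      then show "Re (g x + w * \<psi> x) \<le> ln C + (R\<^sup>2 + (cmod w)\<^sup>2) / 2" using re[of x w] by argo
    qed
    moreover have "cmod (g 0 + w * \<psi> 0) \<le> cmod (g 0) + cmod w * cmod (\<psi> 0)"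
      using norm_triangle_ineq[of "g 0" "w * \<psi> 0"] by (simp add: norm_mult)
    moreover have "2 * (ln C + (R\<^sup>2 + (cmod w)\<^sup>2) / 2) \<le> 2 * \<bar>ln C\<bar> + R\<^sup>2 + (cmod w)\<^sup>2"
      using abs_ge_self[of "ln C"] by argo
    ultimately show ?thesis by argo
  qed
  define D where "D = 4 * \<bar>ln C\<bar> + 6 * cmod (g 0) + 4"
  define E where "E = 3 + 3 * cmod (\<psi> 0) + D"
  have D: "0 \<le> D" by (simp add: D_def)
  have lin: "cmod (\<psi> z) \<le> 6 * cmod z + E" for z
  proof -
    \<comment> \<open>\<open>R\<close> serves both as the radius and as the constant
      \<open>w\<close>. Adding the bounds for \<open>w = R\<close> and \<open>w = 0\<close> isolates
      \<open>R * \<psi> z\<close>, which is at most quadratic in \<open>R\<close>; division by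
      \<open>R\<close> leaves linear growth. \<open>D\<close> collects the constant terms of the two
      bounds.\<close>
    define R where "R = 2 * cmod z + 1"
    have R: "1 \<le> R" "cmod z \<le> R / 2" by (auto simp: R_def)
    have "R * cmod (\<psi> z) = cmod ((g z + of_real R * \<psi> z) - g z)" using R by (simp add: norm_mult)
    also have "\<dots> \<le> cmod (g z + of_real R * \<psi> z) + cmod (g z)" by (rule norm_triangle_ineq4)
    also have "\<dots> \<le> 3 * R\<^sup>2 + 3 * R * cmod (\<psi> 0) + D"
      using bound[of R z "of_real R"] bound[of R z 0] R by (simp add: D_def algebra_simps)
    also have "\<dots> \<le> R * (3 * R + 3 * cmod (\<psi> 0) + D)"
      using mult_right_mono[OF R(1) D] by (simp add: algebra_simps power2_eq_square)
    finally have "cmod (\<psi> z) \<le> 3 * R + 3 * cmod (\<psi> 0) + D"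
      using R(1) by (simp add: mult_le_cancel_left)
    then show ?thesis by (simp add: R_def E_def)
  qed
  have poly: "\<psi> z = (\<Sum>k\<le>1. (deriv ^^ k) \<psi> 0 / fact k * z ^ k)" for z
  proof (rule Liouville_polynomial[OF \<psi>, of 1 "6 + E"])
    fix z :: complex assume z: "1 \<le> norm z"
    have "E \<le> E * norm z"
      using mult_left_mono[OF z, of E] D by (simp add: E_def)
    then show "norm (\<psi> z) \<le> (6 + E) * norm z ^ 1" using lin[of z] by (simp add: algebra_simps)
  qed
  have "\<psi> z = deriv \<psi> 0 * z + \<psi> 0" for z
    using poly[of z] by (simp add: atMost_Suc)
  then show thesis by (rule that)
qed

text \<open>If |a| \<ge> 1, then |a z + b|^2 - |z|^2 \<ge> 2 Re (cnj b a z). The zero-free entire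
  function \<open>?F\<close> would then tend to 0 at infinity and so vanish identically.\<close>

lemma contraction_if_weighted_decay:
  assumes u: "u holomorphic_on UNIV" and nz: "\<And>z. u z \<noteq> 0"
    and decay: "((\<lambda>z. cmod (u z) * exp ((cmod (a * z + b))\<^sup>2 / 2 - (cmod z)\<^sup>2 / 2)) \<longlongrightarrow> 0) at_infinity"
  shows "cmod a < 1"
proof (rule ccontr)
  assume "\<not> cmod a < 1"
  then have a: "1 \<le> cmod a" by simp
  let ?F = "\<lambda>z. u z * exp (cnj b * a * z)"
  have "cmod (?F z) \<le> cmod (u z) * exp ((cmod (a * z + b))\<^sup>2 / 2 - (cmod z)\<^sup>2 / 2)" for z
  proof -
    have "(cmod (a * z + b))\<^sup>2 = (cmod a)\<^sup>2 * (cmod z)\<^sup>2 + (cmod b)\<^sup>2 + 2 * Re (cnj b * a * z)"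
      unfolding cmod_power2 by (simp add: power2_eq_square algebra_simps)
    moreover have "(cmod z)\<^sup>2 \<le> (cmod a)\<^sup>2 * (cmod z)\<^sup>2"
      using mult_right_mono[of 1 "(cmod a)\<^sup>2" "(cmod z)\<^sup>2"] a by simp
    ultimately have "Re (cnj b * a * z) \<le> (cmod (a * z + b))\<^sup>2 / 2 - (cmod z)\<^sup>2 / 2"
      using zero_le_power2[of "cmod b"] by linarith
    then show ?thesis
      by (simp add: norm_mult mult_left_mono del: times_complex.simps)
  qed
  then have "(?F \<longlongrightarrow> 0) at_infinity"
    by (intro Lim_null_comparison[OF _ decay]) auto
  then have "?F 0 = 0"
    by (intro Liouville_weak_0) (intro holomorphic_intros u)
  with nz show False by simp
qed

section \<open>Spaces with Gaussian growth and kernels of bounded norm\<close>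

text \<open>The normalised reproducing kernel of the Hilbert case p = 2. Its modulus times exp (-
  |z|^2 / 2) is exp (- |z - w|^2 / 2), a bump of height 1 at \<open>w\<close>.\<close>

definition fock_kernel :: "complex \<Rightarrow> cfun" where
  "fock_kernel w = (\<lambda>z. exp (cnj w * z - of_real ((cmod w)\<^sup>2 / 2)))"

locale fock_like_space = normed_function_space +
  assumes holo: "\<And>f. f \<in> X \<Longrightarrow> f holomorphic_on UNIV"
    and growth: "\<exists>C. \<forall>f\<in>X. \<forall>z. cmod (f z) \<le> C * exp ((cmod z)\<^sup>2 / 2) * N f"
    and kernel_mem: "\<And>w. fock_kernel w \<in> X"
    and kernel_norm: "\<exists>K. \<forall>w. N (fock_kernel w) \<le> K"
begin

lemma growthE:
  obtains C where "0 < C" "\<And>f z. f \<in> X \<Longrightarrow> cmod (f z) \<le> C * exp ((cmod z)\<^sup>2 / 2) * N f"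
proof -
  obtain C where C: "\<forall>f\<in>X. \<forall>z. cmod (f z) \<le> C * exp ((cmod z)\<^sup>2 / 2) * N f"
    using growth by blast
  show thesis
  proof (rule that[of "max C 1"])
    fix f z assume "f \<in> X"
    then have "cmod (f z) \<le> C * exp ((cmod z)\<^sup>2 / 2) * N f" using C by blast
    also have "\<dots> \<le> max C 1 * exp ((cmod z)\<^sup>2 / 2) * N f"
      by (intro mult_right_mono norm_nonneg) auto
    finally show "cmod (f z) \<le> max C 1 * exp ((cmod z)\<^sup>2 / 2) * N f" .
  qed auto
qed

end

text \<open>The two remaining locale axioms are derived: the growth bound controls evaluations, and
  the kernel at 0 is the constant 1.\<close>

lemma fock_like_spaceI:
  assumes "\<And>f g. f \<in> X \<Longrightarrow> g \<in> X \<Longrightarrow> (\<lambda>z. f z + g z) \<in> X"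
    and "\<And>f c. f \<in> X \<Longrightarrow> (\<lambda>z. c * f z) \<in> X"
    and "\<And>f. 0 \<le> N f" and "\<And>f. N (\<lambda>z. - f z) = N f"
    and "\<And>f g. f \<in> X \<Longrightarrow> g \<in> X \<Longrightarrow> N (\<lambda>z. f z + g z) \<le> N f + N g"
    and "\<And>f c. f \<in> X \<Longrightarrow> N (\<lambda>z. c * f z) = cmod c * N f"
    and "\<And>f. f \<in> X \<Longrightarrow> f holomorphic_on UNIV"
    and growth: "\<And>f z. f \<in> X \<Longrightarrow> cmod (f z) \<le> C * exp ((cmod z)\<^sup>2 / 2) * N f"
    and kernel: "\<And>w. fock_kernel w \<in> X" "\<And>w. N (fock_kernel w) \<le> K"
  shows "fock_like_space X N"
proof
  show "\<exists>L. \<forall>f\<in>X. cmod (f z) \<le> L * N f" for z using growth by blast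
  show "(\<lambda>z. 1) \<in> X" using kernel(1)[of 0] by (simp add: fock_kernel_def)
qed (use assms in blast)+

lemma norm_fock_kernel_diag: "cmod (fock_kernel w w) = exp ((cmod w)\<^sup>2 / 2)"
proof -
  have "Re (cnj w * w) = (cmod w)\<^sup>2" unfolding cmod_power2 by (simp add: power2_eq_square)
  then show ?thesis by (simp add: fock_kernel_def del: times_complex.simps)
qed

lemma fock_kernel_tendsto_0: "((\<lambda>w. fock_kernel w \<zeta>) \<longlongrightarrow> 0) at_infinity"
proof (rule Lim_null_comparison)
  show "\<forall>\<^sub>F w in at_infinity. norm (fock_kernel w \<zeta>) \<le> exp (- cmod w)"
    unfolding eventually_at_infinity
  proof (intro exI allI impI)
    \<comment> \<open>From this radius on |w| (|\<zeta>| + 1) \<le> |w|^2 / 2, so the Gaussian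
      factor beats the linear exponent by a margin of |w|.\<close>
    fix w :: complex assume w: "2 * (cmod \<zeta> + 1) \<le> norm w"
    have "Re (cnj w * \<zeta>) \<le> cmod w * cmod \<zeta>"
      using complex_Re_le_cmod[of "cnj w * \<zeta>"] by (simp add: norm_mult del: times_complex.simps)
    moreover have "cmod w * (cmod \<zeta> + 1) \<le> cmod w * (cmod w / 2)"
      using w by (intro mult_left_mono) auto
    ultimately have "Re (cnj w * \<zeta>) - (cmod w)\<^sup>2 / 2 \<le> - cmod w"
      by (simp add: power2_eq_square algebra_simps)
    then show "norm (fock_kernel w \<zeta>) \<le> exp (- cmod w)"
      by (simp add: fock_kernel_def del: times_complex.simps)
  qed
  show "((\<lambda>w::complex. exp (- cmod w)) \<longlongrightarrow> 0) at_infinity"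
    by (intro filterlim_compose[OF exp_at_bot] filterlim_compose[OF filterlim_uminus_at_bot_at_top]
        filterlim_norm_at_top)
qed

section \<open>Compact power bounded weighted composition operators\<close>

locale fock_weighted_composition = fock_like_space +
  fixes u \<psi> :: cfun
  assumes compact_weighted_comp: "compact_operator X N (weighted_comp u \<psi>)"
    and power_bounded_weighted_comp: "power_bounded X N (weighted_comp u \<psi>)"
    and u_holo: "u holomorphic_on UNIV" and \<psi>_holo: "\<psi> holomorphic_on UNIV"
    and u_nonzero: "\<And>z. u z \<noteq> 0"
begin

sublocale compact_power_bounded_operator X N "weighted_comp u \<psi>"
  by unfold_locales (fact compact_weighted_comp power_bounded_weighted_comp)+

abbreviation "W \<equiv> weighted_comp u \<psi>"

lemma W_kernel_bound:
  obtains C where "0 < C" "\<And>z. cmod (u z) * exp ((cmod (\<psi> z))\<^sup>2 / 2)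
    \<le> C * exp ((cmod z)\<^sup>2 / 2) * N (W (fock_kernel (\<psi> z)))"
proof -
  obtain C where C: "0 < C" "\<And>f z. f \<in> X \<Longrightarrow> cmod (f z) \<le> C * exp ((cmod z)\<^sup>2 / 2) * N f"
    using growthE by blast
  show thesis
  proof (rule that[OF C(1)])
    fix z
    have "cmod (W (fock_kernel (\<psi> z)) z) = cmod (u z) * exp ((cmod (\<psi> z))\<^sup>2 / 2)"
      by (simp add: weighted_comp_def norm_mult norm_fock_kernel_diag)
    with C(2)[OF mem[OF kernel_mem], of "\<psi> z" z]
    show "cmod (u z) * exp ((cmod (\<psi> z))\<^sup>2 / 2)
      \<le> C * exp ((cmod z)\<^sup>2 / 2) * N (W (fock_kernel (\<psi> z)))"
      by simp
  qed
qed

lemma \<psi>_affine: obtains a b where "\<And>z. \<psi> z = a * z + b"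
proof -
  obtain K where K: "\<And>w. N (fock_kernel w) \<le> K" using kernel_norm by blast
  obtain M where M: "0 \<le> M" "\<And>n f. f \<in> X \<Longrightarrow> N ((W ^^ n) f) \<le> M * N f"
    using power_boundE by blast
  obtain C where C: "0 < C" "\<And>z. cmod (u z) * exp ((cmod (\<psi> z))\<^sup>2 / 2)
    \<le> C * exp ((cmod z)\<^sup>2 / 2) * N (W (fock_kernel (\<psi> z)))"
    using W_kernel_bound by blast
  have WK: "N (W (fock_kernel w)) \<le> M * K" for w
    using M(2)[OF kernel_mem, of 1 w] mult_left_mono[OF K M(1), of w] by simp
  have "cmod (u z) * exp ((cmod (\<psi> z))\<^sup>2 / 2) \<le> (C * (M * K)) * exp ((cmod z)\<^sup>2 / 2)" for z
  proof -
    have "C * exp ((cmod z)\<^sup>2 / 2) * N (W (fock_kernel (\<psi> z))) \<le> C * exp ((cmod z)\<^sup>2 / 2) * (M * K)"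
      using C(1) by (intro mult_left_mono WK) auto
    then show ?thesis using C(2)[of z] by (simp add: algebra_simps)
  qed
  then show thesis
    by (rule affine_if_weighted_growth[OF u_holo \<psi>_holo u_nonzero _ that])
qed

lemma norm_W_kernel_tendsto_0: "((\<lambda>w. N (W (fock_kernel w))) \<longlongrightarrow> 0) at_infinity"
proof (rule tendstoI)
  fix e :: real assume e: "0 < e"
  obtain K where K: "\<And>w. N (fock_kernel w) \<le> K" using kernel_norm by blast
  show "\<forall>\<^sub>F w in at_infinity. dist (N (W (fock_kernel w))) 0 < e"
  proof (rule ccontr)
    assume "\<not> ?thesis"
    \<comment> \<open>The compactness argument needs sequences, so a failure of the limit is sampled
      at points of modulus at least \<open>n\<close>.\<close>
    then have "\<forall>n::nat. \<exists>w. real n \<le> cmod w \<and> e \<le> N (W (fock_kernel w))"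
      using norm_nonneg unfolding eventually_at_infinity by (force simp: not_less dist_real_def)
    then obtain w where w: "\<And>n::nat. real n \<le> cmod (w n)" "\<And>n. e \<le> N (W (fock_kernel (w n)))"
      by metis
    have "filterlim (\<lambda>n. cmod (w n)) at_top sequentially"
      by (rule filterlim_at_top_mono[OF filterlim_real_sequentially]) (simp add: w(1))
    then have winf: "filterlim w at_infinity sequentially"
      by (rule filterlim_norm_at_top_imp_at_infinity)
    have "(\<lambda>n. N (W (fock_kernel (w n)))) \<longlonglongrightarrow> 0"
    proof (rule pointwise_null_imp_norm_null[OF kernel_mem K])
      fix z
      show "(\<lambda>n. W (fock_kernel (w n)) z) \<longlonglongrightarrow> 0"
        using tendsto_mult_left[OF filterlim_compose[OF fock_kernel_tendsto_0[of "\<psi> z"] winf], of "u z"]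
        by (simp add: weighted_comp_def)
    qed
    then have "e \<le> 0" using w(2) by (meson LIMSEQ_le_const)
    with e show False by simp
  qed
qed

lemma \<psi>_contraction:
  assumes \<psi>: "\<And>z. \<psi> z = a * z + b"
  shows "cmod a < 1"
proof (rule ccontr)
  assume "\<not> cmod a < 1"
  \<comment> \<open>Under the negated claim \<open>a\<close> is not 0, hence \<open>\<psi>\<close>
    tends to infinity at infinity and the decay of \<open>W\<close> on kernels pulls back along
    \<open>\<psi>\<close>.\<close>
  then have a: "a \<noteq> 0" "\<not> cmod a < 1" by auto
  have "filterlim (\<lambda>z. a * z + b) at_infinity at_infinity"
    by (rule tendsto_add_filterlim_at_infinity'[OF tendsto_mult_filterlim_at_infinity[OF
        tendsto_const a(1) filterlim_ident] tendsto_const])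
  then have lim: "((\<lambda>z. N (W (fock_kernel (\<psi> z)))) \<longlongrightarrow> 0) at_infinity"
    using filterlim_compose[OF norm_W_kernel_tendsto_0] by (simp flip: \<psi>)
  obtain C where C: "0 < C" "\<And>z. cmod (u z) * exp ((cmod (\<psi> z))\<^sup>2 / 2)
    \<le> C * exp ((cmod z)\<^sup>2 / 2) * N (W (fock_kernel (\<psi> z)))"
    using W_kernel_bound by blast
  have "((\<lambda>z. cmod (u z) * exp ((cmod (a * z + b))\<^sup>2 / 2 - (cmod z)\<^sup>2 / 2)) \<longlongrightarrow> 0) at_infinity"
  proof (rule Lim_null_comparison)
    show "\<forall>\<^sub>F z in at_infinity. norm (cmod (u z) * exp ((cmod (a * z + b))\<^sup>2 / 2 - (cmod z)\<^sup>2 / 2))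
      \<le> C * N (W (fock_kernel (\<psi> z)))"
      using C(2) unfolding \<psi>[symmetric]
      by (intro always_eventually allI) (simp add: exp_diff pos_divide_le_eq mult_ac)
    show "((\<lambda>z. C * N (W (fock_kernel (\<psi> z)))) \<longlongrightarrow> 0) at_infinity"
      using tendsto_mult_left[OF lim, of C] by simp
  qed
  from contraction_if_weighted_decay[OF u_holo u_nonzero this] a(2) show False by simp
qed

text \<open>Centred at its fixed point \<open>z0\<close>, the \<open>n\<close>-th iterate of
  \<open>\<psi>\<close> is multiplication by \<open>a ^ n\<close>; the accumulated weight is the
  \<open>n\<close>-th iterate of the constant 1, whose size power boundedness controls.\<close>

lemma W_pow_affine:
  assumes \<psi>: "\<And>z. \<psi> z - z0 = a * (z - z0)"
  shows "(W ^^ n) f z = (W ^^ n) (\<lambda>z. 1) z * f (z0 + a ^ n * (z - z0))"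
proof (induction n arbitrary: z)
  case (Suc n)
  have "(W ^^ Suc n) f z = u z * (W ^^ n) f (\<psi> z)" by (simp add: weighted_comp_def)
  also have "\<dots> = (W ^^ Suc n) (\<lambda>z. 1) z * f (z0 + a ^ n * (\<psi> z - z0))"
    unfolding Suc.IH[of "\<psi> z"] by (simp add: weighted_comp_def)
  finally show ?case by (simp add: \<psi> mult_ac)
qed simp

text \<open>The accumulated weight at \<open>z\<close> stays bounded. The \<open>f j\<close> are
  uniformly bounded on the unit disc about \<open>z0\<close> and vanish at its centre, so the
  Schwarz lemma bounds them by a multiple of the distance to \<open>z0\<close>, which shrinks like
  \<open>cmod a ^ j\<close>.\<close>

lemma W_pow_pointwise_null:
  assumes \<psi>: "\<And>z. \<psi> z - z0 = a * (z - z0)" and a: "cmod a < 1"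
    and f: "\<And>j. f j \<in> X" "\<And>j. f j z0 = 0" "\<And>j. N (f j) \<le> 1"
  shows "(\<lambda>j. (W ^^ j) (f j) z) \<longlonglongrightarrow> 0"
proof -
  obtain C where C: "0 < C" "\<And>f z. f \<in> X \<Longrightarrow> cmod (f z) \<le> C * exp ((cmod z)\<^sup>2 / 2) * N f"
    using growthE by blast
  obtain M where M: "0 \<le> M" "\<And>n f. f \<in> X \<Longrightarrow> N ((W ^^ n) f) \<le> M * N f"
    using power_boundE by blast
  obtain L where L: "0 \<le> L" "\<And>f. f \<in> X \<Longrightarrow> cmod (f z) \<le> L * N f"
    using eval_boundE by blast
  \<comment> \<open>The growth bound on the unit disc about \<open>z0\<close>, increased by 1
    because the Schwarz lemma wants a strict inequality.\<close>
  define B where "B = C * exp ((cmod z0 + 1)\<^sup>2 / 2) + 1"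
  have B: "0 < B" using C(1) by (simp add: B_def add_pos_pos)
  have fB: "cmod (f j (z0 + \<xi>)) < B" if "cmod \<xi> < 1" for j \<xi>
  proof -
    have "cmod (z0 + \<xi>) \<le> cmod z0 + 1" using norm_triangle_ineq[of z0 \<xi>] that by linarith
    then have "(cmod (z0 + \<xi>))\<^sup>2 \<le> (cmod z0 + 1)\<^sup>2" by (intro power_mono) auto
    then have "C * exp ((cmod (z0 + \<xi>))\<^sup>2 / 2) * N (f j) \<le> C * exp ((cmod z0 + 1)\<^sup>2 / 2) * 1"
      using C(1) f(3) norm_nonneg by (intro mult_mono) auto
    then show ?thesis using C(2)[OF f(1), of j "z0 + \<xi>"] by (simp add: B_def)
  qed
  have Schwarz: "cmod (f j (z0 + \<xi>)) \<le> B * cmod \<xi>" if "cmod \<xi> < 1" for j \<xi>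
  proof -
    let ?\<phi> = "\<lambda>\<xi>. f j (z0 + \<xi>) / of_real B"
    have "(\<lambda>\<xi>. f j (z0 + \<xi>)) holomorphic_on UNIV"
      by (rule holomorphic_on_compose_gen[OF _ holo[OF f(1)], unfolded o_def])
        (auto intro!: holomorphic_intros)
    then have "?\<phi> holomorphic_on ball 0 1"
      using B by (intro holomorphic_intros) (auto intro: holomorphic_on_subset)
    moreover have "?\<phi> 0 = 0" by (simp add: f(2))
    moreover have "cmod (?\<phi> \<xi>) < 1" if "cmod \<xi> < 1" for \<xi>
      using fB[OF that] B by (simp add: norm_divide)
    ultimately have "cmod (?\<phi> \<xi>) \<le> cmod \<xi>" using Schwarz_Lemma(1)[of ?\<phi> \<xi>] that by blast
    then show ?thesis using B by (simp add: norm_divide pos_divide_le_eq mult.commute)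
  qed
  have pow: "(\<lambda>j. cmod a ^ j * cmod (z - z0)) \<longlonglongrightarrow> 0"
    using tendsto_mult_right[OF LIMSEQ_power_zero[of "cmod a"], of "cmod (z - z0)"] a by simp
  show ?thesis
  proof (rule Lim_null_comparison)
    \<comment> \<open>The Schwarz estimate applies once the orbit of \<open>z\<close> has entered
      the unit disc about \<open>z0\<close>.\<close>
    have "\<forall>\<^sub>F j in sequentially. cmod a ^ j * cmod (z - z0) < 1"
      using order_tendstoD(2)[OF pow, of 1] by simp
    then show "\<forall>\<^sub>F j in sequentially. norm ((W ^^ j) (f j) z)
      \<le> (L * (M * N (\<lambda>z. 1))) * (B * (cmod a ^ j * cmod (z - z0)))"
    proof (rule eventually_mono)
      fix j assume "cmod a ^ j * cmod (z - z0) < 1"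
      then have "cmod (f j (z0 + a ^ j * (z - z0))) \<le> B * (cmod a ^ j * cmod (z - z0))"
        using Schwarz[of "a ^ j * (z - z0)" j] by (simp add: norm_mult norm_power)
      moreover have "cmod ((W ^^ j) (\<lambda>z. 1) z) \<le> L * (M * N (\<lambda>z. 1))"
        using L(2)[OF pow_mem[OF one_mem], of j] mult_left_mono[OF M(2)[OF one_mem] L(1), of j]
        by linarith
      ultimately show "norm ((W ^^ j) (f j) z)
        \<le> (L * (M * N (\<lambda>z. 1))) * (B * (cmod a ^ j * cmod (z - z0)))"
        unfolding W_pow_affine[OF \<psi>, of j "f j"] norm_mult
        using L(1) M(1) norm_nonneg by (intro mult_mono) auto
    qed
    show "(\<lambda>j. (L * (M * N (\<lambda>z. 1))) * (B * (cmod a ^ j * cmod (z - z0)))) \<longlonglongrightarrow> 0"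
      using tendsto_mult_left[OF tendsto_mult_left[OF pow]] by force
  qed
qed

theorem affine_contraction_and_mean_ergodic:
  "(\<exists>a b. cmod a < 1 \<and> (\<forall>z. \<psi> z = a * z + b)) \<and> uniformly_mean_ergodic X N W"
proof -
  obtain a b where \<psi>: "\<And>z. \<psi> z = a * z + b" using \<psi>_affine by blast
  have a: "cmod a < 1" by (rule \<psi>_contraction[OF \<psi>])
  define z0 where "z0 = b / (1 - a)"
  have "1 - a \<noteq> 0" using a by auto
  then have fixp: "\<psi> z - z0 = a * (z - z0)" for z
    by (simp add: \<psi> z0_def field_simps)
  have \<psi>z0: "\<psi> z0 = z0" using fixp[of z0] by simp
  have null: "(\<lambda>j. (W ^^ j) (f j) z) \<longlonglongrightarrow> 0"
    if "\<And>j. f j \<in> X" "\<And>j. f j z0 = 0" "\<And>j. N (f j) \<le> 1" for f z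
    by (rule W_pow_pointwise_null[OF fixp a that])
  obtain \<delta> where \<delta>: "\<delta> \<longlonglongrightarrow> 0" "\<And>m f. f \<in> X \<Longrightarrow> f z0 = 0 \<Longrightarrow> N ((W ^^ m) f) \<le> \<delta> m * N f"
    using decay_if_pointwise[of z0, OF null] by blast
  have "uniformly_mean_ergodic X N W"
  proof (rule uniformly_mean_ergodic_if_decay)
    show "\<delta> \<longlonglongrightarrow> 0" by (fact \<delta>(1))
    show "N ((W ^^ m) f) \<le> \<delta> m * N f" if "f \<in> X" "f z0 = 0" for m f
      by (rule \<delta>(2)[OF that])
    show "W f z0 = W (\<lambda>z. 1) z0 * f z0" for f
      by (simp add: weighted_comp_def \<psi>z0)
  qed
  then show ?thesis using a \<psi> by blast
qed

end

section \<open>Norm, growth and kernels of the Fock spaces\<close>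

text \<open>Transfers area measure to \<open>real^2\<close>, where the measure of an orthogonal
  image is known.\<close>

lemma lborel_complex_eq_distr_vec:
  "distr lborel borel (\<lambda>x::real^2. Complex (x $ 1) (x $ 2)) = lborel"
proof (rule lborel_eqI[symmetric])
  fix l u :: complex assume le: "\<And>b. b \<in> Basis \<Longrightarrow> l \<bullet> b \<le> u \<bullet> b"
  let ?\<phi> = "\<lambda>x::real^2. Complex (x $ 1) (x $ 2)"
  have [measurable]: "?\<phi> \<in> borel_measurable borel"
    by (intro borel_measurable_continuous_onI) (auto intro!: continuous_intros simp: Complex_eq)
  have le': "Re l \<le> Re u" "Im l \<le> Im u" using le[of 1] le[of \<i>] by (auto simp: Basis_complex_def)
  have Basis2: "(Basis :: (real^2) set) = {axis 1 1, axis 2 1}"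
    by (auto simp: Basis_vec_def UNIV_2)
  have ne: "(axis 1 1 :: real^2) \<noteq> axis 2 1" by (simp add: axis_eq_axis)
  have eq: "?\<phi> -` box l u = box (vector [Re l, Im l]) (vector [Re u, Im u])"
    by (auto simp: box_def Basis_complex_def Basis2 inner_axis)
  have "emeasure (distr lborel borel ?\<phi>) (box l u) = emeasure lborel (?\<phi> -` box l u)"
    by (subst emeasure_distr) auto
  also have "\<dots> = (\<Prod>b\<in>Basis. (vector [Re u, Im u] - vector [Re l, Im l] :: real^2) \<bullet> b)"
    unfolding eq using le' by (intro emeasure_lborel_box) (auto simp: Basis2 inner_axis)
  also have "(\<Prod>b\<in>Basis. (vector [Re u, Im u] - vector [Re l, Im l] :: real^2) \<bullet> b) = (\<Prod>b\<in>Basis. (u - l) \<bullet> b)"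
    unfolding Basis2 Basis_complex_def using ne by (simp add: inner_axis complex_eq_iff)
  finally show "emeasure (distr lborel borel ?\<phi>) (box l u) = (\<Prod>b\<in>Basis. (u - l) \<bullet> b)" .
qed simp

lemma lborel_distr_rotation:
  fixes c :: complex
  assumes c: "cmod c = 1"
  shows "distr lborel borel ((*) c) = lborel"
proof (rule lborel_eqI[symmetric])
  fix l u :: complex assume le: "\<And>b. b \<in> Basis \<Longrightarrow> l \<bullet> b \<le> u \<bullet> b"
  define \<phi> where "\<phi> = (\<lambda>x::real^2. Complex (x $ 1) (x $ 2))"
  have \<phi>_meas [measurable]: "\<phi> \<in> borel_measurable borel"
    unfolding \<phi>_def by (intro borel_measurable_continuous_onI) (auto intro!: continuous_intros simp: Complex_eq)
  have \<phi>_distr: "emeasure lborel A = emeasure lborel (\<phi> -` A)" if "A \<in> sets borel" for A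
  proof -
    have "emeasure lborel A = emeasure (distr lborel borel \<phi>) A"
      using lborel_complex_eq_distr_vec by (simp add: \<phi>_def)
    also have "\<dots> = emeasure lborel (\<phi> -` A)" using that by (subst emeasure_distr) auto
    finally show ?thesis .
  qed
  have cc: "Re c * Re c + Im c * Im c = 1"
    using c cmod_power2[of c] by (simp add: power2_eq_square)
  \<comment> \<open>Multiplication by \<open>cnj c\<close> in coordinates. It inverts multiplication
    by \<open>c\<close>, so a preimage under the latter becomes a direct image under
    \<open>L\<close>.\<close>
  define L where "L x = (vector [Re c * x $ 1 + Im c * x $ 2, Re c * x $ 2 - Im c * x $ 1] :: real^2)" for x :: "real^2"
  have L: "orthogonal_transformation L"
    unfolding orthogonal_transformation_def
  proof (intro conjI allI)
    show "linear L"
      by (rule linearI) (auto simp: L_def vec_eq_iff forall_2 algebra_simps)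
    fix v w :: "real^2"
    have "L v \<bullet> L w = (Re c * Re c + Im c * Im c) * (v \<bullet> w)"
      by (simp add: L_def inner_vec_def sum_2 algebra_simps)
    then show "L v \<bullet> L w = v \<bullet> w" by (simp add: cc)
  qed
  have \<phi>L: "\<phi> (L x) = cnj c * \<phi> x" for x
    by (simp add: \<phi>_def L_def complex_eq_iff)
  have cc': "c * cnj c = 1" using complex_norm_square[of c] c by simp
  let ?S = "\<phi> -` box l u" and ?T = "\<phi> -` ((*) c -` box l u)"
  have "?T = L ` ?S"
  proof (intro equalityI subsetI)
    fix x assume "x \<in> ?T"
    \<comment> \<open>The coordinates of \<open>c * \<phi> x\<close>, hence the point that
      \<open>L\<close> sends to \<open>x\<close>.\<close>
    define y where "y = (vector [Re c * x $ 1 - Im c * x $ 2, Re c * x $ 2 + Im c * x $ 1] :: real^2)"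
    have "\<phi> y = c * \<phi> x" by (simp add: \<phi>_def y_def complex_eq_iff)
    then have "y \<in> ?S" using \<open>x \<in> ?T\<close> by simp
    moreover have "x = L y"
    proof -
      have "Re c * (Re c * x $ 1 - Im c * x $ 2) + Im c * (Re c * x $ 2 + Im c * x $ 1) = (Re c * Re c + Im c * Im c) * x $ 1"
        "Re c * (Re c * x $ 2 + Im c * x $ 1) - Im c * (Re c * x $ 1 - Im c * x $ 2) = (Re c * Re c + Im c * Im c) * x $ 2"
        by (auto simp: algebra_simps)
      then show ?thesis by (simp add: vec_eq_iff forall_2 L_def y_def cc)
    qed
    ultimately show "x \<in> L ` ?S" by blast
  next
    fix x assume "x \<in> L ` ?S"
    then obtain y where y: "x = L y" "\<phi> y \<in> box l u" by auto
    have "c * \<phi> x = \<phi> y" using cc' by (simp add: y(1) \<phi>L flip: mult.assoc)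
    then show "x \<in> ?T" using y by simp
  qed
  moreover have c_box: "(*) c -` box l u \<in> sets borel"
    by (intro measurable_sets_borel[of _ borel]) auto
  then have "?S \<in> sets borel" "?T \<in> sets borel"
    by (auto intro: measurable_sets_borel[OF \<phi>_meas])
  \<comment> \<open>Finiteness lets invariance of the real-valued \<open>measure\<close> be read as
    invariance of \<open>emeasure\<close>.\<close>
  moreover have "emeasure lborel ?S < \<infinity>"
    using \<phi>_distr[of "box l u"] emeasure_lborel_box_finite[of l u] by simp
  ultimately have "emeasure lborel ?T = emeasure lborel ?S"
  proof -
    assume *: "?T = L ` ?S" "?S \<in> sets borel" "?T \<in> sets borel" "emeasure lborel ?S < \<infinity>"
    then have S: "?S \<in> lmeasurable" by (intro fmeasurableI) auto
    have T: "?T \<in> lmeasurable" and m: "measure lebesgue ?T = measure lebesgue ?S"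
      unfolding *(1) using measurable_orthogonal_image[OF L S] measure_orthogonal_image[OF L S] by auto
    have "emeasure lebesgue ?T = emeasure lebesgue ?S"
      using S T m by (simp add: emeasure_eq_measure2)
    then show ?thesis using *(2,3) by simp
  qed
  moreover have "emeasure (distr lborel borel ((*) c)) (box l u) = emeasure lborel ((*) c -` box l u)"
    by (subst emeasure_distr) auto
  ultimately have "emeasure (distr lborel borel ((*) c)) (box l u) = emeasure lborel (box l u)"
    using \<phi>_distr c_box by simp
  then show "emeasure (distr lborel borel ((*) c)) (box l u) = (\<Prod>b\<in>Basis. (u - l) \<bullet> b)"
    using le by simp
qed simp

lemma nn_integral_rotation:
  fixes g :: "complex \<Rightarrow> ennreal"
  assumes "cmod c = 1" and [measurable]: "g \<in> borel_measurable borel"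
  shows "(\<integral>\<^sup>+z. g (c * z) \<partial>lborel) = (\<integral>\<^sup>+z. g z \<partial>lborel)"
  using nn_integral_distr[of "(*) c" lborel borel g] lborel_distr_rotation[OF assms(1)] by simp

lemma nn_integral_translation:
  fixes g :: "complex \<Rightarrow> ennreal"
  assumes [measurable]: "g \<in> borel_measurable borel"
  shows "(\<integral>\<^sup>+z. g (z + c) \<partial>lborel) = (\<integral>\<^sup>+z. g z \<partial>lborel)"
  using nn_integral_distr[of "(+) c" lborel borel g] lborel_distr_plus[of c] by (simp add: add.commute)

section \<open>Mean value inequalities\<close>

text \<open>Cauchy's formula for \<open>w \<mapsto> f (z * w)\<close> on the unit circle. Keeping
  \<open>z\<close> as a factor makes the mean depend on \<open>z\<close> only through a rotated
  argument, ready for integration over \<open>z\<close>.\<close>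

lemma entire_circle_mean:
  assumes f: "f holomorphic_on UNIV"
  shows "((\<lambda>t. f (z * exp (2 * of_real pi * \<i> * of_real t))) has_integral f 0) {0..1}"
proof -
  let ?g = "\<lambda>w. f (z * w)"
  have "?g holomorphic_on cball 0 1"
    by (intro holomorphic_on_compose_gen[OF _ f, unfolded o_def] holomorphic_intros) auto
  then have "((\<lambda>u. ?g u / (u - 0)) has_contour_integral (2 * of_real pi * \<i> * ?g 0)) (circlepath 0 1)"
    by (rule Cauchy_integral_circlepath_simple) simp
  moreover define c where "c = 2 * of_real pi * \<i>"
  ultimately have "((\<lambda>t. c * f (z * exp (2 * of_real pi * \<i> * of_real t))) has_integral c * f 0) {0..1}"
    unfolding has_contour_integral vector_derivative_circlepath c_def by (simp add: circlepath mult_ac)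
  moreover have "c \<noteq> 0" by (simp add: c_def)
  ultimately show ?thesis
    using has_integral_mult_right[of "\<lambda>t. c * f (z * exp (2 * of_real pi * \<i> * of_real t))" "c * f 0" "{0..1}" "inverse c"]
    by (simp add: mult.assoc[symmetric])
qed

lemma holomorphic_imp_borel_measurable:
  "f holomorphic_on UNIV \<Longrightarrow> f \<in> borel_measurable borel"
  by (intro borel_measurable_continuous_onI holomorphic_on_imp_continuous_on)

text \<open>In place of Jensen's inequality, x \<le> 1/2 + (2 x)^q / 2 is integrated over the
  circle, giving 1 \<le> |f 0| \<le> 1/2 + J/2. The factor 2 inside the power costs only a
  constant.\<close>

lemma circle_mean_powr_ge_1:
  assumes f: "f holomorphic_on UNIV" and f0: "1 \<le> cmod (f 0)" and q: "1 \<le> q"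
  shows "1 \<le> (\<integral>\<^sup>+t. ennreal ((2 * cmod (f (z * exp (2 * of_real pi * \<i> * of_real t)))) powr q)
    * indicator {0..1::real} t \<partial>lborel)"
proof -
  define F where "F t = cmod (f (z * exp (2 * of_real pi * \<i> * of_real t)))" for t :: real
  have cont: "continuous_on {0..1} (\<lambda>t. f (z * exp (2 * of_real pi * \<i> * of_real t)))"
    by (intro continuous_on_compose2[OF holomorphic_on_imp_continuous_on[OF f]] continuous_intros) auto
  then have cF: "continuous_on {0..1} F" unfolding F_def by (rule continuous_on_norm)
  then have cP: "continuous_on {0..1} (\<lambda>t. (2 * F t) powr q)"
    using q by (intro continuous_on_powr' continuous_intros) (auto simp: F_def)
  define J where "J = integral {0..1} (\<lambda>t. (2 * F t) powr q)"
  have J: "((\<lambda>t. (2 * F t) powr q) has_integral J) {0..1}"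
    unfolding J_def using cP by (intro integrable_integral integrable_continuous_interval)
  have young: "x \<le> 1/2 + (2 * x) powr q / 2" if "0 \<le> x" for x :: real
  proof (cases "2 * x \<le> 1")
    case True
    then show ?thesis using powr_ge_zero[of "2 * x" q] by linarith
  next
    case False
    then have "(2 * x) powr 1 \<le> (2 * x) powr q" using q by (intro powr_mono) auto
    then show ?thesis using that by simp
  qed
  have "((\<lambda>t. 1/2 + (2 * F t) powr q / 2) has_integral (1/2 + J / 2)) {0..1}"
    using has_integral_add[OF has_integral_const_real[of "1/2::real" 0 1] has_integral_divide[OF J, of 2]]
    by simp
  then have "cmod (f 0) \<le> 1/2 + J / 2"
    using integral_norm_bound_integral[of "\<lambda>t. f (z * exp (2 * of_real pi * \<i> * of_real t))" "{0..1}"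
        "\<lambda>t. 1/2 + (2 * F t) powr q / 2"]
      entire_circle_mean[OF f, of z] young
    by (auto simp: F_def has_integral_iff)
  then have "1 \<le> J" using f0 by simp
  then have "1 \<le> ennreal J" by simp
  also have "ennreal J = (\<integral>\<^sup>+t. ennreal ((2 * F t) powr q) * indicator {0..1} t \<partial>lborel)"
    by (rule nn_integral_has_integral_lebesgue'[OF _ J, symmetric]) simp
  finally show ?thesis by (simp add: F_def)
qed

text \<open>\<open>fock_size\<close> at a finite exponent without the factor
  \<open>p / (2 * pi)\<close>, which is restored only when the norm is assembled.\<close>

definition fock_integral :: "real \<Rightarrow> cfun \<Rightarrow> ennreal" where
  "fock_integral q f = (\<integral>\<^sup>+z. ennreal (cmod (f z) powr q * exp (- (q * (cmod z)\<^sup>2 / 2))) \<partial>lborel)"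

text \<open>
  Integrating the mean value property along the circle through \<open>z\<close> over all \<open>z\<close> in the unit disc,
  Tonelli and rotation invariance give an area mean value inequality without polar coordinates.
\<close>

lemma fock_integral_ge:
  assumes q: "1 \<le> q"
  obtains \<kappa> where "0 < \<kappa>"
    "\<And>f. f holomorphic_on UNIV \<Longrightarrow> 1 \<le> cmod (f 0) \<Longrightarrow> ennreal \<kappa> \<le> fock_integral q f"
proof -
  define V where "V = measure lborel (ball (0::complex) 1)"
  have emV: "emeasure lborel (ball (0::complex) 1) = ennreal V"
    unfolding V_def by (intro emeasure_eq_ennreal_measure) (use emeasure_lborel_ball_finite[of "0::complex" 1] in auto)
  have V: "0 < V" unfolding V_def by (rule content_ball_pos) simp
  \<comment> \<open>\<open>2 powr q\<close> pays for the factor 2 in the circle mean,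
    \<open>exp (q / 2)\<close> for the Gaussian weight on the unit disc.\<close>
  define A where "A = 2 powr q * exp (q / 2)"
  have A: "0 < A" by (simp add: A_def)
  show thesis
  proof (rule that[of "V / A"])
    fix f assume f: "f holomorphic_on UNIV" and f0: "1 \<le> cmod (f 0)"
    note [measurable] = holomorphic_imp_borel_measurable[OF f]
    let ?e = "\<lambda>t::real. exp (2 * of_real pi * \<i> * of_real t)"
    let ?B = "ball (0::complex) 1"
    have [measurable]: "?B \<in> sets borel" by simp
    have ne: "cmod (?e t) = 1" for t by (simp add: norm_exp_eq_Re)
    \<comment> \<open>The indicator of the disc is invariant under rotation, so after exchanging the
      integrals the factor \<open>?e t\<close> can be rotated away for each fixed
      \<open>t\<close>.\<close>
    define G where "G z t = indicator ?B z * (ennreal ((2 * cmod (f (z * ?e t))) powr q) * indicator {0..1} t)" for z t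
    have G [measurable]: "case_prod G \<in> borel_measurable (lborel \<Otimes>\<^sub>M lborel)"
    proof -
      have "(\<lambda>x. f (fst x * ?e (snd x))) \<in> borel_measurable (lborel \<Otimes>\<^sub>M lborel)"
        unfolding lborel_prod measurable_lborel2
        by (intro borel_measurable_continuous_onI continuous_on_compose2[OF holomorphic_on_imp_continuous_on[OF f]]
            continuous_intros) auto
      then have "(\<lambda>x. ennreal ((2 * cmod (f (fst x * ?e (snd x)))) powr q)) \<in> borel_measurable (lborel \<Otimes>\<^sub>M lborel)"
        by measurable
      moreover have "indicator (?B \<times> {0..1::real}) \<in> borel_measurable (lborel \<Otimes>\<^sub>M lborel)"
        by (intro borel_measurable_indicator pair_measureI) auto
      ultimately have "(\<lambda>x. ennreal ((2 * cmod (f (fst x * ?e (snd x)))) powr q) * indicator (?B \<times> {0..1::real}) x)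
          \<in> borel_measurable (lborel \<Otimes>\<^sub>M lborel)"
        by (rule borel_measurable_times_ennreal)
      moreover have "case_prod G = (\<lambda>x. ennreal ((2 * cmod (f (fst x * ?e (snd x)))) powr q) * indicator (?B \<times> {0..1::real}) x)"
        by (auto simp: G_def indicator_def fun_eq_iff)
      ultimately show ?thesis by simp
    qed
    have "ennreal V = (\<integral>\<^sup>+z. indicator ?B z * 1 \<partial>lborel)" using emV by simp
    also have "\<dots> \<le> (\<integral>\<^sup>+z. \<integral>\<^sup>+t. G z t \<partial>lborel \<partial>lborel)"
    proof (rule nn_integral_mono)
      fix z :: complex
      have "(\<integral>\<^sup>+t. G z t \<partial>lborel) = indicator ?B z * (\<integral>\<^sup>+t. ennreal ((2 * cmod (f (z * ?e t))) powr q) * indicator {0..1} t \<partial>lborel)"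
        unfolding G_def by (rule nn_integral_cmult) measurable
      then show "indicator ?B z * 1 \<le> (\<integral>\<^sup>+t. G z t \<partial>lborel)"
        using circle_mean_powr_ge_1[OF f f0 q, of z] by (cases "z \<in> ?B") auto
    qed
    also have "\<dots> = (\<integral>\<^sup>+t. \<integral>\<^sup>+z. G z t \<partial>lborel \<partial>lborel)"
      by (rule lborel_pair.Fubini'[OF G, symmetric])
    also have "\<dots> = (\<integral>\<^sup>+t. (\<integral>\<^sup>+z. indicator ?B z * ennreal ((2 * cmod (f z)) powr q) \<partial>lborel) * indicator {0..1::real} t \<partial>lborel)"
    proof (rule nn_integral_cong)
      fix t :: real
      have "(\<integral>\<^sup>+z. G z t \<partial>lborel) = (\<integral>\<^sup>+z. indicator ?B (?e t * z) * ennreal ((2 * cmod (f (?e t * z))) powr q) * indicator {0..1} t \<partial>lborel)"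
        unfolding G_def by (intro nn_integral_cong) (auto simp: indicator_def norm_mult ne mult_ac)
      also have "\<dots> = (\<integral>\<^sup>+z. indicator ?B z * ennreal ((2 * cmod (f z)) powr q) * indicator {0..1} t \<partial>lborel)"
        by (rule nn_integral_rotation[OF ne]) measurable
      also have "\<dots> = (\<integral>\<^sup>+z. indicator ?B z * ennreal ((2 * cmod (f z)) powr q) \<partial>lborel) * indicator {0..1} t"
        by (rule nn_integral_multc) measurable
      finally show "(\<integral>\<^sup>+z. G z t \<partial>lborel) = (\<integral>\<^sup>+z. indicator ?B z * ennreal ((2 * cmod (f z)) powr q) \<partial>lborel) * indicator {0..1} t" .
    qed
    also have "\<dots> = (\<integral>\<^sup>+z. indicator ?B z * ennreal ((2 * cmod (f z)) powr q) \<partial>lborel)"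
      by (simp add: nn_integral_cmult)
    also have "\<dots> \<le> (\<integral>\<^sup>+z. ennreal A * ennreal (cmod (f z) powr q * exp (- (q * (cmod z)\<^sup>2 / 2))) \<partial>lborel)"
    proof (rule nn_integral_mono)
      fix z :: complex
      show "indicator ?B z * ennreal ((2 * cmod (f z)) powr q)
        \<le> ennreal A * ennreal (cmod (f z) powr q * exp (- (q * (cmod z)\<^sup>2 / 2)))"
      proof (cases "z \<in> ?B")
        case True
        then have "(cmod z)\<^sup>2 \<le> 1" by (simp add: power_le_one)
        then have "q * (cmod z)\<^sup>2 \<le> q" using q mult_left_mono[of "(cmod z)\<^sup>2" 1 q] by simp
        then have le: "1 \<le> exp (q / 2 - q * (cmod z)\<^sup>2 / 2)" by simp
        have "(2 * cmod (f z)) powr q \<le> A * (cmod (f z) powr q * exp (- (q * (cmod z)\<^sup>2 / 2)))"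
        proof -
          have "A * (cmod (f z) powr q * exp (- (q * (cmod z)\<^sup>2 / 2)))
              = (2 powr q * cmod (f z) powr q) * exp (q / 2 - q * (cmod z)\<^sup>2 / 2)"
            unfolding A_def diff_conv_add_uminus exp_add by (simp only: mult_ac)
          moreover have "(2 powr q * cmod (f z) powr q) * 1
              \<le> (2 powr q * cmod (f z) powr q) * exp (q / 2 - q * (cmod z)\<^sup>2 / 2)"
            by (rule mult_left_mono[OF le]) simp
          ultimately show ?thesis by (simp only: powr_mult mult_1_right)
        qed
        then show ?thesis using True A by (simp add: ennreal_mult'[symmetric] ennreal_leI)
      qed simp
    qed
    also have "\<dots> = ennreal A * fock_integral q f"
      unfolding fock_integral_def by (rule nn_integral_cmult) measurable
    finally have "ennreal V \<le> ennreal A * fock_integral q f" .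
    then have "ennreal (1 / A) * ennreal V \<le> ennreal (1 / A) * (ennreal A * fock_integral q f)"
      by (rule mult_left_mono) simp
    also have "\<dots> = fock_integral q f"
      using A by (simp add: mult.assoc[symmetric] ennreal_mult'[symmetric])
    finally show "ennreal (V / A) \<le> fock_integral q f"
      using A V by (simp add: ennreal_mult'[symmetric])
  qed (use V A in simp)
qed

section \<open>Pointwise growth and kernels for finite exponents\<close>

lemma fock_integral_scale:
  assumes [measurable]: "f \<in> borel_measurable borel"
  shows "fock_integral q (\<lambda>z. c * f z) = ennreal (cmod c powr q) * fock_integral q f"
proof -
  have "fock_integral q (\<lambda>z. c * f z)
    = (\<integral>\<^sup>+z. ennreal (cmod c powr q) * ennreal (cmod (f z) powr q * exp (- (q * (cmod z)\<^sup>2 / 2))) \<partial>lborel)"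
    unfolding fock_integral_def
    by (intro nn_integral_cong) (simp add: norm_mult powr_mult ennreal_mult'[symmetric] mult.assoc)
  also have "\<dots> = ennreal (cmod c powr q) * fock_integral q f"
    unfolding fock_integral_def by (rule nn_integral_cmult) measurable
  finally show ?thesis .
qed

lemma cmod_add_squared: "(cmod (z + w))\<^sup>2 = (cmod z)\<^sup>2 + (cmod w)\<^sup>2 + 2 * Re (cnj w * z)"
  unfolding cmod_power2 by (simp add: power2_eq_square algebra_simps)

text \<open>
  The Weyl translation \<open>f \<mapsto> f (\<cdot> + w) * exp (- cnj w \<cdot> - \<bar>w\<bar>\<^sup>2 / 2)\<close> is isometric and carries
  evaluation at \<open>w\<close> to evaluation at 0.
\<close>

lemma fock_integral_Weyl_translation:
  assumes [measurable]: "f \<in> borel_measurable borel"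
  shows "fock_integral q (\<lambda>z. f (z + w) * exp (- cnj w * z - of_real ((cmod w)\<^sup>2 / 2))) = fock_integral q f"
proof -
  let ?h = "\<lambda>z. ennreal (cmod (f z) powr q * exp (- (q * (cmod z)\<^sup>2 / 2)))"
  have "cmod (f (z + w) * exp (- cnj w * z - of_real ((cmod w)\<^sup>2 / 2))) powr q * exp (- (q * (cmod z)\<^sup>2 / 2))
    = cmod (f (z + w)) powr q * exp (- (q * (cmod (z + w))\<^sup>2 / 2))" for z
  proof -
    have "cmod (exp (- cnj w * z - of_real ((cmod w)\<^sup>2 / 2))) powr q * exp (- (q * (cmod z)\<^sup>2 / 2))
      = exp (- (q * (cmod (z + w))\<^sup>2 / 2))"
      unfolding cmod_add_squared
      by (simp add: powr_def exp_add[symmetric] algebra_simps add_divide_distrib diff_divide_distrib)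
    then show ?thesis by (simp add: norm_mult powr_mult mult.assoc)
  qed
  then have "fock_integral q (\<lambda>z. f (z + w) * exp (- cnj w * z - of_real ((cmod w)\<^sup>2 / 2)))
    = (\<integral>\<^sup>+z. ?h (z + w) \<partial>lborel)"
    unfolding fock_integral_def by simp
  also have "\<dots> = fock_integral q f"
    unfolding fock_integral_def by (rule nn_integral_translation) measurable
  finally show ?thesis .
qed

text \<open>Weyl translation moves \<open>w\<close> to 0, and division by the weighted modulus
  \<open>r\<close> at \<open>w\<close> normalises the value there to modulus 1. The lower bound at 0
  then applies, and homogeneity returns the factor \<open>r powr q\<close>.\<close>

lemma fock_integral_growth:
  assumes q: "1 \<le> q"
  obtains \<kappa> where "0 < \<kappa>"
    "\<And>f w. f holomorphic_on UNIV \<Longrightarrow>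
      ennreal (\<kappa> * (cmod (f w) * exp (- ((cmod w)\<^sup>2 / 2))) powr q) \<le> fock_integral q f"
proof -
  obtain \<kappa> where \<kappa>: "0 < \<kappa>"
    "\<And>f. f holomorphic_on UNIV \<Longrightarrow> 1 \<le> cmod (f 0) \<Longrightarrow> ennreal \<kappa> \<le> fock_integral q f"
    using fock_integral_ge[OF q] by blast
  show thesis
  proof (rule that[OF \<kappa>(1)])
    fix f and w :: complex assume f: "f holomorphic_on UNIV"
    define r where "r = cmod (f w) * exp (- ((cmod w)\<^sup>2 / 2))"
    show "ennreal (\<kappa> * (cmod (f w) * exp (- ((cmod w)\<^sup>2 / 2))) powr q) \<le> fock_integral q f"
    proof (cases "r = 0")
      case False
      then have r: "0 < r" by (simp add: r_def)
      let ?g = "\<lambda>z. f (z + w) * exp (- cnj w * z - of_real ((cmod w)\<^sup>2 / 2))"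
      let ?c = "of_real (1 / r) :: complex"
      have g: "?g holomorphic_on UNIV"
        by (intro holomorphic_intros holomorphic_on_compose_gen[OF _ f, unfolded o_def]) auto
      have "cmod (?g 0) = r" by (simp add: r_def norm_mult)
      then have "ennreal \<kappa> \<le> fock_integral q (\<lambda>z. ?c * ?g z)"
        using r by (intro \<kappa>(2) holomorphic_intros g) (simp add: norm_mult norm_divide)
      also have "\<dots> = ennreal (cmod ?c powr q) * fock_integral q f"
        using fock_integral_scale[OF holomorphic_imp_borel_measurable[OF g], of q ?c]
          fock_integral_Weyl_translation[OF holomorphic_imp_borel_measurable[OF f]] by simp
      finally have "ennreal (r powr q) * ennreal \<kappa> \<le> ennreal (r powr q) * (ennreal (cmod ?c powr q) * fock_integral q f)"
        by (rule mult_left_mono) simp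
      also have "\<dots> = fock_integral q f"
        using r by (simp add: mult.assoc[symmetric] ennreal_mult'[symmetric] powr_mult[symmetric] norm_divide)
      finally show ?thesis
        using \<kappa>(1) by (simp add: r_def ennreal_mult'[symmetric] mult.commute)
    qed (auto simp: r_def)
  qed
qed

text \<open>The Gaussian factorises over real and imaginary part, and each factor is a multiple of
  the normal density of variance \<open>1 / q\<close>.\<close>

lemma fock_integral_one_finite:
  assumes q: "0 < q"
  shows "fock_integral q (\<lambda>z. 1) < \<infinity>"
proof -
  let ?g = "\<lambda>x::real. exp (- (q * x\<^sup>2 / 2))"
  have "?g = (\<lambda>x. sqrt (2 * pi / q) * normal_density 0 (1 / sqrt q) x)"
    using q by (auto simp: normal_density_def power_divide real_sqrt_divide real_sqrt_mult fun_eq_iff field_simps)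
  then have "integrable lborel ?g" using q by (simp add: integrable_normal_density)
  then have fin: "(\<integral>\<^sup>+x. ennreal (?g x) \<partial>lborel) < \<infinity>"
    by (subst nn_integral_eq_integral) auto
  have "fock_integral q (\<lambda>z. 1) = (\<integral>\<^sup>+z. (\<Prod>b\<in>Basis. ennreal (?g (z \<bullet> b))) \<partial>(lborel :: complex measure))"
    unfolding fock_integral_def cmod_power2
    by (intro nn_integral_cong)
      (simp add: Basis_complex_def ennreal_mult'[symmetric] exp_add[symmetric] algebra_simps add_divide_distrib)
  also have "\<dots> = (\<Prod>b\<in>(Basis::complex set). (\<integral>\<^sup>+x. ennreal (?g x) \<partial>lborel))"
    by (rule nn_integral_lborel_prod) auto
  also have "\<dots> < \<infinity>"
    using fin by (simp add: Basis_complex_def ennreal_mult_less_top)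
  finally show ?thesis .
qed

text \<open>Weyl translation by \<open>w\<close> turns the kernel at \<open>w\<close> into the
  constant 1, so all kernels have the same norm.\<close>

lemma fock_integral_kernel:
  "fock_integral q (fock_kernel w) = fock_integral q (\<lambda>z. 1)"
proof -
  have "(\<lambda>z. fock_kernel w (z + w) * exp (- cnj w * z - of_real ((cmod w)\<^sup>2 / 2))) = (\<lambda>z. 1)"
  proof
    fix z
    have "cnj w * w = of_real ((cmod w)\<^sup>2)" using complex_norm_square[of w] by (simp add: mult.commute)
    then have "cnj w * (z + w) - of_real ((cmod w)\<^sup>2 / 2) + (- cnj w * z - of_real ((cmod w)\<^sup>2 / 2)) = 0"
      by (simp add: algebra_simps)
    then show "fock_kernel w (z + w) * exp (- cnj w * z - of_real ((cmod w)\<^sup>2 / 2)) = 1"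
      unfolding fock_kernel_def exp_add[symmetric] by simp
  qed
  moreover have "fock_kernel w \<in> borel_measurable borel"
    unfolding fock_kernel_def by (intro holomorphic_imp_borel_measurable holomorphic_intros)
  ultimately show ?thesis using fock_integral_Weyl_translation[of "fock_kernel w" q w] by simp
qed

section \<open>Minkowski's inequality\<close>

text \<open>Convexity on the positive reals, extended to the endpoint 0, where the claim reduces to
  \<open>s powr q \<le> s\<close>.\<close>

lemma powr_convex_combination:
  fixes x y :: real
  assumes "0 \<le> x" "0 \<le> y" "0 < s" "0 < t" "s + t = 1" "1 \<le> q"
  shows "(s * x + t * y) powr q \<le> s * x powr q + t * y powr q"
proof -
  have shrink: "(s * x) powr q \<le> s * x powr q" if "0 \<le> x" "0 < s" "s \<le> 1" for s x :: real
  proof -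
    have "s powr q \<le> s powr 1" using that assms(6) by (intro powr_mono') auto
    then show ?thesis using that by (simp add: powr_mult mult_right_mono)
  qed
  show ?thesis
  proof (cases "x = 0 \<or> y = 0")
    case True
    then show ?thesis using shrink[of y t] shrink[of x s] assms by auto
  next
    case False
    have s: "s = 1 - t" using assms(5) by simp
    show ?thesis
      using convex_onD[OF powr_convex[OF assms(6)], of t x y] assms False unfolding s by simp
  qed
qed

text \<open>Here \<open>\<alpha>\<close> and \<open>\<beta>\<close> stand for the norms of
  \<open>f\<close> and \<open>g\<close>. Writing |f| + |g| as \<alpha> + \<beta> times a convex
  combination of |f| / \<alpha> and |g| / \<beta> reduces the inequality to pointwise convexity of
  the power.\<close>

lemma fock_integral_Minkowski:
  assumes [measurable]: "f \<in> borel_measurable borel" "g \<in> borel_measurable borel"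
    and q: "1 \<le> q" and \<alpha>: "0 < \<alpha>" and \<beta>: "0 < \<beta>"
    and f: "fock_integral q f \<le> ennreal (A * \<alpha> powr q)" and g: "fock_integral q g \<le> ennreal (A * \<beta> powr q)"
    and A: "0 \<le> A"
  shows "fock_integral q (\<lambda>z. f z + g z) \<le> ennreal (A * (\<alpha> + \<beta>) powr q)"
proof -
  define s t where "s = \<alpha> / (\<alpha> + \<beta>)" and "t = \<beta> / (\<alpha> + \<beta>)"
  have st: "0 < s" "0 < t" "s + t = 1" using \<alpha> \<beta> by (auto simp: s_def t_def add_divide_distrib[symmetric])
  \<comment> \<open>Against the hypotheses on \<open>f\<close> and \<open>g\<close> the factors
    \<open>\<alpha> powr q\<close> and \<open>\<beta> powr q\<close> cancel, leaving
    \<open>A * (\<alpha> + \<beta>) powr q * (s + t)\<close>.\<close>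
  define a b where "a = (\<alpha> + \<beta>) powr q * s * (1 / \<alpha>) powr q" and "b = (\<alpha> + \<beta>) powr q * t * (1 / \<beta>) powr q"
  have ab: "0 \<le> a" "0 \<le> b" using st by (auto simp: a_def b_def)
  have pointwise: "cmod (f z + g z) powr q \<le> a * cmod (f z) powr q + b * cmod (g z) powr q" for z
  proof -
    have "(s * (cmod (f z) / \<alpha>) + t * (cmod (g z) / \<beta>)) powr q
        \<le> s * (cmod (f z) / \<alpha>) powr q + t * (cmod (g z) / \<beta>) powr q"
      using \<alpha> \<beta> st q by (intro powr_convex_combination) auto
    moreover have "cmod (f z) + cmod (g z) = (\<alpha> + \<beta>) * (s * (cmod (f z) / \<alpha>) + t * (cmod (g z) / \<beta>))"
    proof -
      have "(\<alpha> + \<beta>) * s = \<alpha>" "(\<alpha> + \<beta>) * t = \<beta>"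
        using \<alpha> \<beta> by (auto simp: s_def t_def)
      then have "(\<alpha> + \<beta>) * (s * (cmod (f z) / \<alpha>)) = cmod (f z)" "(\<alpha> + \<beta>) * (t * (cmod (g z) / \<beta>)) = cmod (g z)"
        using \<alpha> \<beta> by (auto simp flip: mult.assoc)
      then show ?thesis by (simp add: distrib_left)
    qed
    ultimately have "(cmod (f z) + cmod (g z)) powr q
        \<le> (\<alpha> + \<beta>) powr q * (s * (cmod (f z) / \<alpha>) powr q + t * (cmod (g z) / \<beta>) powr q)"
      using \<alpha> \<beta> st by (simp add: powr_mult mult_left_mono)
    also have "\<dots> = a * cmod (f z) powr q + b * cmod (g z) powr q"
      using \<alpha> \<beta> by (simp add: a_def b_def powr_divide algebra_simps)
    finally have "(cmod (f z) + cmod (g z)) powr q \<le> a * cmod (f z) powr q + b * cmod (g z) powr q" .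
    moreover have "cmod (f z + g z) powr q \<le> (cmod (f z) + cmod (g z)) powr q"
      using q by (intro powr_mono2 norm_triangle_ineq) auto
    ultimately show ?thesis by linarith
  qed
  let ?w = "\<lambda>z. exp (- (q * (cmod z)\<^sup>2 / 2))"
  have "fock_integral q (\<lambda>z. f z + g z)
    \<le> (\<integral>\<^sup>+z. ennreal a * ennreal (cmod (f z) powr q * ?w z) + ennreal b * ennreal (cmod (g z) powr q * ?w z) \<partial>lborel)"
    unfolding fock_integral_def
  proof (rule nn_integral_mono)
    fix z
    have "cmod (f z + g z) powr q * ?w z \<le> (a * cmod (f z) powr q + b * cmod (g z) powr q) * ?w z"
      by (intro mult_right_mono pointwise) auto
    then show "ennreal (cmod (f z + g z) powr q * ?w z)
      \<le> ennreal a * ennreal (cmod (f z) powr q * ?w z) + ennreal b * ennreal (cmod (g z) powr q * ?w z)"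
      using ab by (simp add: ennreal_mult'[symmetric] ennreal_plus[symmetric] ennreal_leI algebra_simps del: ennreal_plus)
  qed
  also have "\<dots> = ennreal a * fock_integral q f + ennreal b * fock_integral q g"
    unfolding fock_integral_def by (subst nn_integral_add) (auto simp: nn_integral_cmult)
  also have "\<dots> \<le> ennreal a * ennreal (A * \<alpha> powr q) + ennreal b * ennreal (A * \<beta> powr q)"
    by (intro add_mono mult_left_mono f g) auto
  also have "\<dots> = ennreal (a * (A * \<alpha> powr q) + b * (A * \<beta> powr q))"
    using ab A by (simp add: ennreal_mult'[symmetric] ennreal_plus[symmetric] del: ennreal_plus)
  also have "a * (A * \<alpha> powr q) + b * (A * \<beta> powr q) = A * (\<alpha> + \<beta>) powr q * (s + t)"
    using \<alpha> \<beta> by (simp add: a_def b_def powr_divide field_simps)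
  finally show ?thesis using st by simp
qed

section \<open>Verification for finite exponents\<close>

lemma fock_space_finite_eq:
  assumes "1 \<le> p" "p \<noteq> \<infinity>"
  shows "fock_space p = {f. f holomorphic_on UNIV \<and> fock_integral (enn2real p) f < \<infinity>}"
    and "fock_norm p f = (enn2real p / (2 * pi) * enn2real (fock_integral (enn2real p) f)) powr (1 / enn2real p)"
    and "1 \<le> enn2real p"
proof -
  show q: "1 \<le> enn2real p"
    using enn2real_mono[OF assms(1)] assms(2) by (simp add: less_top)
  have size: "fock_size p f = ennreal (enn2real p / (2 * pi)) * fock_integral (enn2real p) f" for f
    using assms(2) by (simp add: fock_size_def fock_integral_def)
  show "fock_space p = {f. f holomorphic_on UNIV \<and> fock_integral (enn2real p) f < \<infinity>}"
    unfolding fock_space_def size using q by (auto simp: ennreal_mult_less_top)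
  show "fock_norm p f = (enn2real p / (2 * pi) * enn2real (fock_integral (enn2real p) f)) powr (1 / enn2real p)"
    unfolding fock_norm_def size using assms(2) q by (simp add: enn2real_mult)
qed

lemma fock_like_space_finite:
  assumes "1 \<le> p" "p \<noteq> \<infinity>"
  shows "fock_like_space (fock_space p) (fock_norm p)"
proof -
  define q where "q = enn2real p"
  define A where "A f = enn2real (fock_integral q f)" for f
  \<comment> \<open>The inverse of the factor in \<open>fock_size\<close>, so that the integral of
    \<open>f\<close> is \<open>k\<close> times the \<open>q\<close>-th power of its norm.\<close>
  define k where "k = 2 * pi / q"
  note fs = fock_space_finite_eq[OF assms, folded q_def]
  have q: "1 \<le> q" by (rule fs(3))
  then have k: "0 < k" by (simp add: k_def)
  let ?X = "fock_space p" and ?N = "fock_norm p"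
  have X: "f \<in> ?X \<longleftrightarrow> f holomorphic_on UNIV \<and> fock_integral q f < \<infinity>" for f
    unfolding fs(1) by simp
  have N: "?N f = (A f / k) powr (1 / q)" for f
    unfolding fs(2) A_def k_def by (simp add: mult.commute)
  have N_powr: "A f = k * ?N f powr q" for f
    using k q by (simp add: N powr_powr A_def)
  have N_le: "?N f \<le> c" if "0 \<le> c" "fock_integral q f \<le> ennreal (k * c powr q)" for f c
  proof -
    have "A f \<le> k * c powr q"
      using enn2real_mono[OF that(2)] k by (simp add: A_def)
    then have "(A f / k) powr (1 / q) \<le> (c powr q) powr (1 / q)"
      using k q by (intro powr_mono2) (auto simp: A_def pos_divide_le_eq mult.commute)
    then show ?thesis using that(1) q by (simp add: N powr_powr)
  qed
  have int_eq: "fock_integral q f = ennreal (k * ?N f powr q)" if "f \<in> ?X" for f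
    using that by (simp add: X A_def flip: N_powr)
  have meas: "f \<in> borel_measurable borel" if "f \<in> ?X" for f
    using that by (intro holomorphic_imp_borel_measurable) (simp add: X)
  have nonneg: "0 \<le> ?N f" for f by (simp add: N)
  obtain \<kappa> where \<kappa>: "0 < \<kappa>"
    "\<And>f w. f holomorphic_on UNIV \<Longrightarrow>
      ennreal (\<kappa> * (cmod (f w) * exp (- ((cmod w)\<^sup>2 / 2))) powr q) \<le> fock_integral q f"
    using fock_integral_growth[OF q] by blast
  \<comment> \<open>Obtained by taking \<open>q\<close>-th roots in
    \<open>\<kappa> * r powr q \<le> k * N f powr q\<close>, with \<open>r\<close> the weighted
    modulus at a point.\<close>
  define C where "C = (k / \<kappa>) powr (1 / q)"
  have growth: "cmod (f z) \<le> C * exp ((cmod z)\<^sup>2 / 2) * ?N f" if f: "f \<in> ?X" for f z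
  proof -
    let ?r = "cmod (f z) * exp (- ((cmod z)\<^sup>2 / 2))"
    have "ennreal (\<kappa> * ?r powr q) \<le> ennreal (k * ?N f powr q)"
      using \<kappa>(2)[of f z] f by (simp add: int_eq[symmetric] X)
    then have "\<kappa> * ?r powr q \<le> k * ?N f powr q"
      using k by (simp add: ennreal_le_iff)
    then have "?r powr q \<le> k / \<kappa> * ?N f powr q"
      using \<kappa>(1) by (simp add: field_simps)
    then have "(?r powr q) powr (1 / q) \<le> (k / \<kappa> * ?N f powr q) powr (1 / q)"
      using q by (intro powr_mono2) auto
    also have "\<dots> = C * ?N f"
      using q k \<kappa>(1) nonneg[of f] by (subst powr_mult) (auto simp: powr_powr C_def)
    finally have "?r \<le> C * ?N f" using q by (simp add: powr_powr)
    then show ?thesis by (simp add: exp_minus field_simps)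
  qed
  have zero: "f = (\<lambda>z. 0)" if "f \<in> ?X" "?N f = 0" for f
    using growth[OF that(1)] that(2) by auto
  have Minkowski: "fock_integral q (\<lambda>z. f z + g z) \<le> ennreal (k * (?N f + ?N g) powr q)"
    if f: "f \<in> ?X" and g: "g \<in> ?X" for f g
  \<comment> \<open>Normalisation needs positive norms; a function of norm 0 is the zero function by
    the growth bound.\<close>
  proof (cases "?N f = 0 \<or> ?N g = 0")
    case True
    then show ?thesis using zero[OF f] zero[OF g] f g by (auto simp: int_eq)
  next
    case False
    then show ?thesis
      using nonneg[of f] nonneg[of g] q k f g
      by (intro fock_integral_Minkowski meas) (auto simp: int_eq)
  qed
  have scale: "fock_integral q (\<lambda>z. c * f z) = ennreal (k * (cmod c * ?N f) powr q)" if f: "f \<in> ?X" for c f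
    using fock_integral_scale[OF meas[OF f]] k nonneg[of f]
    by (simp add: int_eq[OF f] ennreal_mult'[symmetric] powr_mult mult_ac)
  have A_scale: "A (\<lambda>z. c * f z) = k * (cmod c * ?N f) powr q" if "f \<in> ?X" for c f
    unfolding A_def scale[OF that] using k by simp
  show ?thesis
  proof (rule fock_like_spaceI)
    fix f g c
    show "0 \<le> ?N f" by (rule nonneg)
    show "?N (\<lambda>z. - f z) = ?N f" unfolding N A_def fock_integral_def by simp
    assume f: "f \<in> ?X"
    show "(\<lambda>z. c * f z) \<in> ?X"
      using f scale[OF f, of c] by (simp add: X holomorphic_intros)
    show "?N (\<lambda>z. c * f z) = cmod c * ?N f"
      using A_scale[OF f, of c] k q nonneg[of f] by (simp add: N[of "\<lambda>z. c * f z"] powr_powr)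
    show "f holomorphic_on UNIV" using f by (simp add: X)
    show "cmod (f z) \<le> C * exp ((cmod z)\<^sup>2 / 2) * ?N f" for z by (rule growth[OF f])
    assume g: "g \<in> ?X"
    show "(\<lambda>z. f z + g z) \<in> ?X"
      using f g Minkowski[OF f g] by (auto simp: X intro!: holomorphic_intros elim: order_le_less_trans)
    show "?N (\<lambda>z. f z + g z) \<le> ?N f + ?N g"
      using nonneg[of f] nonneg[of g] by (intro N_le Minkowski f g) auto
  next
    fix w
    show "fock_kernel w \<in> ?X"
      using fock_integral_one_finite[of q] q
      by (simp add: X fock_integral_kernel) (auto simp: fock_kernel_def intro!: holomorphic_intros)
    show "?N (fock_kernel w) \<le> ?N (\<lambda>z. 1)"
      by (simp add: N A_def fock_integral_kernel)
  qed
qed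

section \<open>Verification for the supremum norm\<close>

lemma fock_like_space_infinite: "fock_like_space (fock_space top) (fock_norm top)"
proof -
  let ?X = "fock_space top" and ?N = "fock_norm top"
  have size: "fock_size top f = (SUP z. ennreal (cmod (f z) * exp (- ((cmod z)\<^sup>2 / 2))))" for f
    by (simp add: fock_size_def)
  have N: "?N f = enn2real (fock_size top f)" for f by (simp add: fock_norm_def)
  have nonneg: "0 \<le> ?N f" for f unfolding N by simp
  have le_N: "cmod (f z) * exp (- ((cmod z)\<^sup>2 / 2)) \<le> ?N f" if "f \<in> ?X" for f z
  proof -
    have "ennreal (cmod (f z) * exp (- ((cmod z)\<^sup>2 / 2))) \<le> fock_size top f"
      unfolding size by (rule SUP_upper) simp
    also have "\<dots> = ennreal (?N f)" using that unfolding fock_space_def N by simp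
    finally show ?thesis unfolding ennreal_le_iff[OF nonneg] .
  qed
  \<comment> \<open>Membership and norm estimates for sums, multiples and kernels all reduce to such
    a pointwise bound.\<close>
  have bound: "f \<in> ?X" "?N f \<le> B"
    if "f holomorphic_on UNIV" "\<And>z. cmod (f z) * exp (- ((cmod z)\<^sup>2 / 2)) \<le> B" for f B
  proof -
    have "0 \<le> cmod (f 0) * exp (- ((cmod 0)\<^sup>2 / 2))" by simp
    also have "\<dots> \<le> B" by (rule that(2))
    finally have B: "0 \<le> B" .
    have le: "fock_size top f \<le> ennreal B"
      unfolding size by (intro SUP_least ennreal_leI that)
    then show "f \<in> ?X" using that(1) by (auto simp: fock_space_def intro: le_less_trans)
    show "?N f \<le> B" unfolding N using enn2real_mono[OF le] B by simp
  qed
  have hol: "f holomorphic_on UNIV" if "f \<in> ?X" for f using that by (simp add: fock_space_def)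
  have scale: "(\<lambda>z. c * f z) \<in> ?X" "?N (\<lambda>z. c * f z) \<le> cmod c * ?N f" if "f \<in> ?X" for c f
  proof -
    have "cmod (c * f z) * exp (- ((cmod z)\<^sup>2 / 2)) \<le> cmod c * ?N f" for z
      using mult_left_mono[OF le_N[OF that, of z], of "cmod c"] by (simp add: norm_mult mult.assoc)
    then show "(\<lambda>z. c * f z) \<in> ?X" "?N (\<lambda>z. c * f z) \<le> cmod c * ?N f"
      using hol[OF that] by (auto intro!: bound holomorphic_intros)
  qed
  have add: "(\<lambda>z. f z + g z) \<in> ?X" "?N (\<lambda>z. f z + g z) \<le> ?N f + ?N g"
    if "f \<in> ?X" "g \<in> ?X" for f g
  proof -
    have "cmod (f z + g z) * exp (- ((cmod z)\<^sup>2 / 2)) \<le> ?N f + ?N g" for z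
    proof -
      have "cmod (f z + g z) * exp (- ((cmod z)\<^sup>2 / 2))
        \<le> (cmod (f z) + cmod (g z)) * exp (- ((cmod z)\<^sup>2 / 2))"
        by (intro mult_right_mono norm_triangle_ineq) auto
      also have "\<dots> \<le> ?N f + ?N g"
        using le_N[OF that(1), of z] le_N[OF that(2), of z] by (simp add: distrib_right)
      finally show ?thesis .
    qed
    then show "(\<lambda>z. f z + g z) \<in> ?X" "?N (\<lambda>z. f z + g z) \<le> ?N f + ?N g"
      using hol that by (auto intro!: bound holomorphic_intros)
  qed
  have kernel: "cmod (fock_kernel w z) * exp (- ((cmod z)\<^sup>2 / 2)) \<le> 1" for w z
  proof -
    have "Re (cnj w * z) \<le> cmod w * cmod z"
      using complex_Re_le_cmod[of "cnj w * z"] by (simp add: norm_mult del: times_complex.simps)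
    then have "Re (cnj w * z) - (cmod w)\<^sup>2 / 2 - (cmod z)\<^sup>2 / 2 \<le> 0"
      using sum_squares_bound[of "cmod w" "cmod z"] by argo
    then show ?thesis
      by (simp add: fock_kernel_def exp_add[symmetric] del: times_complex.simps)
  qed
  show ?thesis
  proof (rule fock_like_spaceI)
    fix f c
    show "0 \<le> ?N f" by (rule nonneg)
    show "?N (\<lambda>z. - f z) = ?N f" by (simp add: N size)
    assume f: "f \<in> ?X"
    show "(\<lambda>z. c * f z) \<in> ?X" by (rule scale[OF f])
    show "?N (\<lambda>z. c * f z) = cmod c * ?N f"
    proof (cases "c = 0")
      case True
      then show ?thesis using scale(2)[OF f, of 0] nonneg[of "\<lambda>z. 0"] by simp
    next
      case False
      \<comment> \<open>The reverse inequality is the upper bound applied to the factor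
        \<open>1 / c\<close>.\<close>
      have "?N f \<le> cmod (1 / c) * ?N (\<lambda>z. c * f z)"
        using scale(2)[OF scale(1)[OF f, of c], of "1 / c"] False by simp
      then have "cmod c * ?N f \<le> ?N (\<lambda>z. c * f z)"
        using False by (simp add: norm_divide pos_le_divide_eq mult.commute)
      then show ?thesis using scale(2)[OF f, of c] by (rule antisym[rotated])
    qed
    show "f holomorphic_on UNIV" by (rule hol[OF f])
    show "cmod (f z) \<le> 1 * exp ((cmod z)\<^sup>2 / 2) * ?N f" for z
      using le_N[OF f, of z] by (simp add: exp_minus field_simps)
  next
    fix w
    have "fock_kernel w holomorphic_on UNIV"
      unfolding fock_kernel_def by (intro holomorphic_intros)
    then show "fock_kernel w \<in> ?X" "?N (fock_kernel w) \<le> 1"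
      using kernel by (auto intro: bound)
  qed (use add in auto)
qed

theorem proposition4p1:
  fixes p :: ennreal and u \<psi> :: "complex \<Rightarrow> complex"
  assumes "1 \<le> p"
    and "u holomorphic_on UNIV" and "\<psi> holomorphic_on UNIV"
    and "\<forall>z. u z \<noteq> 0"
    and "compact_operator (fock_space p) (fock_norm p) (weighted_comp u \<psi>)"
    and "power_bounded (fock_space p) (fock_norm p) (weighted_comp u \<psi>)"
  shows "(\<exists>a b. cmod a < 1 \<and> (\<forall>z. \<psi> z = a * z + b)) \<and>
    uniformly_mean_ergodic (fock_space p) (fock_norm p) (weighted_comp u \<psi>)"
proof -
  have "fock_like_space (fock_space p) (fock_norm p)"
    using fock_like_space_finite[OF assms(1)] fock_like_space_infinite by (cases "p = \<infinity>") auto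
  then interpret fock_like_space "fock_space p" "fock_norm p" .
  interpret fock_weighted_composition "fock_space p" "fock_norm p" u \<psi>
    using assms by unfold_locales auto
  show ?thesis by (rule affine_contraction_and_mean_ergodic)
qed

end
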